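(* Let $0\le\theta<1$, let $p\ge1$ be an integer, let $r,s\in\mathbb{Z}$ with $s+\tfrac{p\theta}{2}>0$, and let $\tau=r+i(s+\tfrac{p\theta}{2})$. Then, for all $\underline{f}\in\mathcal{H}_{\tau,p}=\mathcal{S}(\mathbb{R})\otimes\mathbb{C}^p$, the transported right $A_\theta^\infty$-module structure $\blacktriangleleft$ is given by $$\underline{f}\blacktriangleleft U=e^{\pi i\frac{r}{p}}\big\{W(\tfrac{s}{p}+\theta,0)\otimes (C^* )^rS\big\}\underline{f},\qquad \underline{f}\blacktriangleleft V=\big\{W(0,1)\otimes (C^* )^s\big\}\underline{f}.$$
   Context: Write $\tau=\omega_x+i\omega_y$ (so $\omega_x=r$, $\omega_y=s+\frac{p\theta}{2}$), and identify $z=x+iy\in\mathbb{C}$ with $(x,y)\in\mathbb{R}^2$. $A_\theta$ is the universal unital $C^*$-algebra generated by two unitaries $U,V$ with $UV=e^{2\pi i\theta}VU$. $A_\theta^\infty$ is the subalgebra of series $\sum_{m,n\in\mathbb{Z}}a_{m,n}U^mV^n$ with rapidly decreasing coefficients. $\mathcal{F}_{\tau,p}$ is the set of all smooth $f:\mathbb{C}\to\mathbb{C}$ with $f(z+1)=f(z)$ and $f(z+\tau)=e^{-\pi ip(\omega_x+2x)}f(z)$ for all $z=x+iy$. For this $\tau$, it is a right $A_\theta^\infty$-module with action determined on generators by $$(f\triangleleft U)(x,y)=e^{2\pi ix}f(x,y-\tfrac12\theta),\qquad (f\triangleleft V)(x,y)=e^{2\pi iy}f(x+\tfrac12\theta,y).$$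 Every $f\in\mathcal{F}_{\tau,p}$ can be written uniquely as $$f(z)=\sum_{n\in\mathbb{Z}}e^{2\pi inx}e^{\pi in^2\frac{\omega_x}{p}}f_{[n]}(y+n\tfrac{\omega_y}{p}),$$ where $[n]=n\bmod p$ and the $p$ functions $f_{[n]}$ belong to the Schwartz space $\mathcal{S}(\mathbb{R})$. The map $\varphi_{\tau,p}:\mathcal{F}_{\tau,p}\to\mathcal{H}_{\tau,p}:=\mathcal{S}(\mathbb{R})\otimes\mathbb{C}^p$, $f\mapsto\underline{f}=(f_{[0]},f_{[1]},\ldots,f_{[p-1]})^t$, is a linear bijection. The transported structure is $\underline{f}\blacktriangleleft a:=\varphi_{\tau,p}\big(\varphi_{\tau,p}^{-1}(\underline{f})\triangleleft a\big)$ for $a\in A_\theta^\infty$. For $a,b\in\mathbb{R}$, the Weyl operator is $\{W(a,b)\psi\}(t)=e^{-\pi iab}e^{2\pi ibt}\psi(t-a)$. Components of $w\in\mathbb{C}^p$ are indexed by residues $n=0,1,\ldots,p-1$ mod $p$. The clock and shift matrices $C,S\in M_p(\mathbb{C})$ are $(Cw)_n=e^{2\pi in/p}w_n$ and $(Sw)_n=w_{n-1\bmod p}$, i.e. $C=\mathrm{diag}(1,e^{2\pi i/p},\ldots,e^{2\pi i(p-1)/p})$ and $S$ is the cyclic shift; $C=S=1$ for $p=1$. *)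

theory Defs
  imports "HOL-Analysis.Analysis" "Jordan_Normal_Form.Schur_Decomposition"
begin

unbundle no vec_syntax
hide_type (open) Finite_Cartesian_Product.vec
hide_const (open) Finite_Cartesian_Product.vec

section \<open>Smooth functions and Schwartz functions\<close>

text \<open>Over the complex plane, \<open>smooth\<close> is real smoothness:
  \<open>differentiable\<close> refers to the underlying real normed space.\<close>

primrec times_differentiable ::
    "nat \<Rightarrow> ('a::real_normed_vector \<Rightarrow> 'b::real_normed_vector) \<Rightarrow> bool" where
  "times_differentiable 0 f \<longleftrightarrow> continuous_on UNIV f"
| "times_differentiable (Suc k) f \<longleftrightarrow>
     (\<forall>x. f differentiable at x) \<and>
     (\<forall>v. times_differentiable k (\<lambda>x. frechet_derivative f (at x) v))"

definition smooth :: "('a::real_normed_vector \<Rightarrow> 'b::real_normed_vector) \<Rightarrow> bool" where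
  "smooth f \<longleftrightarrow> (\<forall>k. times_differentiable k f)"

definition nth_vector_deriv :: "nat \<Rightarrow> (real \<Rightarrow> complex) \<Rightarrow> real \<Rightarrow> complex" where
  "nth_vector_deriv n = (\<lambda>g t. vector_derivative g (at t)) ^^ n"

definition schwartz :: "(real \<Rightarrow> complex) set" where
  "schwartz = {\<psi>. smooth \<psi> \<and>
     (\<forall>k n. bounded (range (\<lambda>t. t ^ k *\<^sub>R nth_vector_deriv n \<psi> t)))}"


section \<open>The smooth noncommutative torus\<close>

text \<open>The element \<open>\<Sum> a m n U\<^sup>m V\<^sup>n\<close> of the smooth algebra is represented by its family
  of coefficients \<open>a\<close>.\<close>

definition smooth_torus :: "(int \<Rightarrow> int \<Rightarrow> complex) set" where
  "smooth_torus = {a. \<forall>k::nat. bounded (range (\<lambda>(m, n).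
     of_int (1 + \<bar>m\<bar> + \<bar>n\<bar>) ^ k * a m n))}"

definition monomial :: "int \<Rightarrow> int \<Rightarrow> int \<Rightarrow> int \<Rightarrow> complex" where
  "monomial k l = (\<lambda>m n. if m = k \<and> n = l then 1 else 0)"

abbreviation gen_U :: "int \<Rightarrow> int \<Rightarrow> complex" where "gen_U \<equiv> monomial 1 0"
abbreviation gen_V :: "int \<Rightarrow> int \<Rightarrow> complex" where "gen_V \<equiv> monomial 0 1"

text \<open>\<open>U V = exp (2 \<pi> \<i> \<theta>) V U\<close> gives
  \<open>(U\<^sup>k V\<^sup>l) (U\<^sup>m V\<^sup>n) = exp (- 2 \<pi> \<i> \<theta> l m) U\<^sup>k\<^sup>+\<^sup>m V\<^sup>l\<^sup>+\<^sup>n\<close>, hence the following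
  twisted convolution.\<close>

definition torus_mult :: "real \<Rightarrow> (int \<Rightarrow> int \<Rightarrow> complex) \<Rightarrow> (int \<Rightarrow> int \<Rightarrow> complex) \<Rightarrow>
    int \<Rightarrow> int \<Rightarrow> complex" where
  "torus_mult \<theta> a b = (\<lambda>m n. \<Sum>\<^sub>\<infinity>(k, l)\<in>UNIV.
     exp (- 2 * pi * \<i> * \<theta> * of_int (l * (m - k))) * a k l * b (m - k) (n - l))"

lemma monomial_in_smooth_torus: "monomial k l \<in> smooth_torus"
proof -
  have "bounded (range (\<lambda>(m, n). of_int (1 + \<bar>m\<bar> + \<bar>n\<bar>) ^ j * monomial k l m n))" for j :: nat
    by (rule bounded_subset[of "{0, of_int (1 + \<bar>k\<bar> + \<bar>l\<bar>) ^ j}"])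
       (auto simp: monomial_def finite_imp_bounded)
  then show ?thesis by (simp add: smooth_torus_def)
qed

lemma torus_mult_monomial:
  "torus_mult \<theta> (monomial k l) (monomial m n) =
     (\<lambda>i j. exp (- 2 * pi * \<i> * \<theta> * of_int (l * m)) * monomial (k + m) (l + n) i j)"
proof (intro ext)
  fix i j
  let ?h = "\<lambda>(k', l'). exp (- 2 * pi * \<i> * \<theta> * of_int (l' * (i - k'))) *
              monomial k l k' l' * monomial m n (i - k') (j - l')"
  have "infsum ?h UNIV = infsum ?h {(k, l)}"
    by (rule infsum_cong_neutral) (auto simp: monomial_def split: if_splits)
  then show "torus_mult \<theta> (monomial k l) (monomial m n) i j =
      exp (- 2 * pi * \<i> * \<theta> * of_int (l * m)) * monomial (k + m) (l + n) i j"
    by (auto simp: torus_mult_def monomial_def)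
qed

lemma torus_commutation:
  "torus_mult \<theta> gen_U gen_V = (\<lambda>m n. exp (2 * pi * \<i> * \<theta>) * torus_mult \<theta> gen_V gen_U m n)"
  by (simp add: torus_mult_monomial mult.assoc[symmetric] exp_add[symmetric])


section \<open>The module of quasi-periodic functions\<close>

definition F_module :: "complex \<Rightarrow> nat \<Rightarrow> (complex \<Rightarrow> complex) set" where
  "F_module \<tau> p = {f. smooth f \<and> (\<forall>z. f (z + 1) = f z) \<and>
     (\<forall>z. f (z + \<tau>) = exp (- pi * \<i> * p * (Re \<tau> + 2 * Re z)) * f z)}"

definition act_U :: "real \<Rightarrow> (complex \<Rightarrow> complex) \<Rightarrow> complex \<Rightarrow> complex" where
  "act_U \<theta> f = (\<lambda>z. exp (2 * pi * \<i> * Re z) * f (Complex (Re z) (Im z - \<theta> / 2)))"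

definition act_V :: "real \<Rightarrow> (complex \<Rightarrow> complex) \<Rightarrow> complex \<Rightarrow> complex" where
  "act_V \<theta> f = (\<lambda>z. exp (2 * pi * \<i> * Im z) * f (Complex (Re z + \<theta> / 2) (Im z)))"

definition iterate_int :: "('a \<Rightarrow> 'a) \<Rightarrow> int \<Rightarrow> 'a \<Rightarrow> 'a" where
  "iterate_int T m = (if 0 \<le> m then T ^^ nat m else inv_into UNIV T ^^ nat (- m))"

text \<open>A right action: \<open>U\<^sup>m V\<^sup>n\<close> acts by \<open>U\<^sup>m\<close> first.\<close>

definition act :: "real \<Rightarrow> (complex \<Rightarrow> complex) \<Rightarrow> (int \<Rightarrow> int \<Rightarrow> complex) \<Rightarrow>
    complex \<Rightarrow> complex" where
  "act \<theta> f a = (\<lambda>z. \<Sum>\<^sub>\<infinity>(m, n)\<in>UNIV.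
     a m n * iterate_int (act_V \<theta>) n (iterate_int (act_U \<theta>) m f) z)"

lemma bij_act_U: "bij (act_U \<theta>)"
proof (rule o_bij)
  let ?g = "\<lambda>f z. exp (- (2 * pi * \<i> * Re z)) * f (Complex (Re z) (Im z + \<theta> / 2))"
  show "?g \<circ> act_U \<theta> = id" "act_U \<theta> \<circ> ?g = id"
    by (auto simp: act_U_def fun_eq_iff exp_minus)
qed

lemma bij_act_V: "bij (act_V \<theta>)"
proof (rule o_bij)
  let ?g = "\<lambda>f z. exp (- (2 * pi * \<i> * Im z)) * f (Complex (Re z - \<theta> / 2) (Im z))"
  show "?g \<circ> act_V \<theta> = id" "act_V \<theta> \<circ> ?g = id"
    by (auto simp: act_V_def fun_eq_iff exp_minus)
qed

lemma act_monomial: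
  "act \<theta> f (monomial k l) = iterate_int (act_V \<theta>) l (iterate_int (act_U \<theta>) k f)"
proof
  fix z
  let ?h = "\<lambda>(m, n). monomial k l m n * iterate_int (act_V \<theta>) n (iterate_int (act_U \<theta>) m f) z"
  have "infsum ?h UNIV = infsum ?h {(k, l)}"
    by (rule infsum_cong_neutral) (auto simp: monomial_def split: if_splits)
  then show "act \<theta> f (monomial k l) z =
      iterate_int (act_V \<theta>) l (iterate_int (act_U \<theta>) k f) z"
    by (simp add: act_def monomial_def)
qed

lemma act_gen:
  "act \<theta> f gen_U = act_U \<theta> f"
  "act \<theta> f gen_V = act_V \<theta> f"
  by (simp_all add: act_monomial iterate_int_def)

lemma act_commutation:
  "act \<theta> (act \<theta> f gen_U) gen_V = (\<lambda>z. exp (2 * pi * \<i> * \<theta>) * act \<theta> (act \<theta> f gen_V) gen_U z)"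
  unfolding act_gen
  by (simp add: act_U_def act_V_def fun_eq_iff mult.assoc[symmetric] exp_add[symmetric])
     (simp add: algebra_simps)


section \<open>The transported module\<close>

text \<open>The tensor product of the Schwartz space with \<open>\<complex>\<^sup>p\<close> is the space of \<open>p\<close>-tuples of
  Schwartz functions.\<close>

definition H_module :: "nat \<Rightarrow> (real \<Rightarrow> complex) Matrix.vec set" where
  "H_module p = {h \<in> carrier_vec p. \<forall>n<p. h $ n \<in> schwartz}"

definition decomposes :: "complex \<Rightarrow> nat \<Rightarrow> (complex \<Rightarrow> complex) \<Rightarrow>
    (real \<Rightarrow> complex) Matrix.vec \<Rightarrow> bool" where
  "decomposes \<tau> p f h \<longleftrightarrow> (\<forall>z. ((\<lambda>n::int.
     exp (2 * pi * \<i> * n * Re z) * exp (pi * \<i> * n\<^sup>2 * (Re \<tau> / p)) *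
     (h $ nat (n mod int p)) (Im z + n * (Im \<tau> / p))) has_sum f z) UNIV)"

definition phi :: "complex \<Rightarrow> nat \<Rightarrow> (complex \<Rightarrow> complex) \<Rightarrow> (real \<Rightarrow> complex) Matrix.vec" where
  "phi \<tau> p f = (THE h. h \<in> H_module p \<and> decomposes \<tau> p f h)"

definition transported_act :: "real \<Rightarrow> complex \<Rightarrow> nat \<Rightarrow> (real \<Rightarrow> complex) Matrix.vec \<Rightarrow>
    (int \<Rightarrow> int \<Rightarrow> complex) \<Rightarrow> (real \<Rightarrow> complex) Matrix.vec" where
  "transported_act \<theta> \<tau> p h a = phi \<tau> p (act \<theta> (inv_into (F_module \<tau> p) (phi \<tau> p) h) a)"


section \<open>Weyl operators, clock and shift\<close>

definition Weyl :: "real \<Rightarrow> real \<Rightarrow> (real \<Rightarrow> complex) \<Rightarrow> real \<Rightarrow> complex" where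
  "Weyl a b \<psi> = (\<lambda>t. exp (- pi * \<i> * a * b) * exp (2 * pi * \<i> * b * t) * \<psi> (t - a))"

definition clock_mat :: "nat \<Rightarrow> complex mat" where
  "clock_mat p = mat p p (\<lambda>(i, j). if i = j then exp (2 * pi * \<i> * i / p) else 0)"

definition shift_mat :: "nat \<Rightarrow> complex mat" where
  "shift_mat p = mat p p (\<lambda>(i, j). if int j = (int i - 1) mod int p then 1 else 0)"

text \<open>Integer powers, with negative ones taken of the inverse matrix.\<close>

definition mat_int_pow :: "nat \<Rightarrow> complex mat \<Rightarrow> int \<Rightarrow> complex mat" where
  "mat_int_pow p M k = M [^]\<^bsub>ring_mat TYPE(complex) p ()\<^esub> k"

text \<open>The operator \<open>A \<otimes> M\<close>, for \<open>A\<close> acting on functions and a square matrix \<open>M\<close>.\<close>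

definition tensor_op :: "((real \<Rightarrow> complex) \<Rightarrow> real \<Rightarrow> complex) \<Rightarrow> complex mat \<Rightarrow>
    (real \<Rightarrow> complex) Matrix.vec \<Rightarrow> (real \<Rightarrow> complex) Matrix.vec" where
  "tensor_op A M h = Matrix.vec (dim_row M)
     (\<lambda>n t. \<Sum>m<dim_col M. M $$ (n, m) * A (h $ m) t)"

definition scale_tuple :: "complex \<Rightarrow> (real \<Rightarrow> complex) Matrix.vec \<Rightarrow> (real \<Rightarrow> complex) Matrix.vec" where
  "scale_tuple c h = map_vec (\<lambda>\<psi> t. c * \<psi> t) h"

end

theory Submission
  imports Defs
begin

text \<open>
  The generators act on the Gauss-phase expansion \<open>\<Sum>n. exp (2\<pi>inx) exp (\<pi>in\<^sup>2\<omega>\<^sub>x/p) f\<^sub>[\<^sub>n\<^sub>] (y + n\<omega>\<^sub>y/p)\<close>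
  termwise: \<open>U\<close> raises the Fourier index by one and \<open>V\<close> multiplies by a mode in \<open>y\<close>, and completing the
  square in the Gauss phase gives the clock and shift factors. What has to be established is that the
  expansion is a bijection between \<^const>\<open>F_module\<close> and \<^const>\<open>H_module\<close>: without it neither
  \<^const>\<open>phi\<close> nor its inverse has a determined value. Synthesis is termwise differentiation of a series
  that decays rapidly on horizontal strips. Conversely, the Fourier coefficients of \<open>f\<close> along
  horizontal lines decay rapidly in \<open>n\<close>, uniformly for bounded \<open>y\<close>, and quasi-periodicity identifies
  translation by \<open>\<omega>\<^sub>y\<close> in \<open>y\<close> with \<open>n \<mapsto> n + p\<close>; so decay in \<open>n\<close> becomes decay of
  \<open>f\<^sub>[\<^sub>n\<^sub>]\<close> at infinity.
\<close>

section \<open>Smooth and Schwartz functions\<close>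

text \<open>Smoothness and the Schwartz property are both proved by exhibiting a class of functions
  closed under differentiation, which avoids formulas for iterated derivatives. The Gauss-phase
  series alone do not form such a class, so the coefficients are widened to arbitrary sequences of
  polynomial growth. Integrality of \<omega>_x = r enters the converse direction twice: a
  translation by \<tau> becomes a vertical one only after a horizontal shift by r, and the phase
  left over in passing from n to n + p is e^(2\<pi>i(nr + pr)) = 1. The value \<omega>_y = s +
  p\<theta>/2 is what makes the generators act through Weyl operators. With \<delta> = \<omega>_y/p,
  rewriting e^(2\<pi>iy) in the variable t = y + n\<delta> costs e^(-2\<pi>in\<delta>). The
  \<theta>-part of this factor cancels against the half-translation of V in x, and what remains,
  e^(-2\<pi>ins/p), depends on n mod p only because s is an integer. For U, the half-translation in
  y and the \<theta>/2 inside \<delta> add up to the full \<theta> of the Weyl operator.\<close>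

lemma times_differentiable_add:
  assumes "times_differentiable k f" "times_differentiable k g"
  shows "times_differentiable k (\<lambda>x. f x + g x)"
  using assms
proof (induction k arbitrary: f g)
  case (Suc k)
  have "((\<lambda>x. f x + g x) has_derivative
      (\<lambda>v. frechet_derivative f (at x) v + frechet_derivative g (at x) v)) (at x)" for x
    using Suc.prems by (auto intro!: has_derivative_add simp: frechet_derivative_works)
  then have "frechet_derivative (\<lambda>x. f x + g x) (at x) v =
      frechet_derivative f (at x) v + frechet_derivative g (at x) v" for x v
    using frechet_derivative_at by metis
  with Suc show ?case by auto
qed (auto intro: continuous_on_add)

lemma times_differentiable_scaleR:
  assumes "times_differentiable k f"
  shows "times_differentiable k (\<lambda>x. c *\<^sub>R f x)"
  using assms
proof (induction k arbitrary: f)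
  case (Suc k)
  have "((\<lambda>x. c *\<^sub>R f x) has_derivative (\<lambda>v. c *\<^sub>R frechet_derivative f (at x) v)) (at x)" for x
    using Suc.prems by (auto intro!: has_derivative_scaleR_right simp: frechet_derivative_works)
  then have "frechet_derivative (\<lambda>x. c *\<^sub>R f x) (at x) v = c *\<^sub>R frechet_derivative f (at x) v" for x v
    using frechet_derivative_at by metis
  with Suc show ?case by auto
qed (auto intro: continuous_on_scaleR)

lemma times_differentiable_zero: "times_differentiable k (\<lambda>x. 0)"
  by (induction k) auto

lemma times_differentiable_sum:
  assumes "finite A" "\<And>i. i \<in> A \<Longrightarrow> times_differentiable k (f i)"
  shows "times_differentiable k (\<lambda>x. \<Sum>i\<in>A. f i x)"
  using assms by (induction A) (auto intro: times_differentiable_add times_differentiable_zero)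

text \<open>Induction on the order of differentiability, over all members of \<open>X\<close> at
  once. By linearity the derivative in direction \<open>v\<close> is a finite combination of
  derivatives along basis vectors, and each of these lies in \<open>X\<close>, so closure has to be
  verified for partial derivatives only.\<close>

lemma smooth_coinduct:
  fixes f :: "'a::euclidean_space \<Rightarrow> 'b::real_normed_vector"
  assumes "f \<in> X"
    and step: "\<And>g. g \<in> X \<Longrightarrow>
      \<exists>D. (\<forall>x. (g has_derivative D x) (at x)) \<and> (\<forall>b\<in>Basis. (\<lambda>x. D x b) \<in> X)"
  shows "smooth f"
proof -
  have "times_differentiable k g" if "g \<in> X" for k g
    using that
  proof (induction k arbitrary: g)
    case 0
    with step[OF 0] have "\<exists>D. (g has_derivative D) (at x)" for x by blast
    then show ?case
      by (auto intro!: differentiable_imp_continuous_on simp: differentiable_on_def differentiable_def)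
  next
    case (Suc k)
    obtain D where D: "\<And>x. (g has_derivative D x) (at x)" "\<And>b. b \<in> Basis \<Longrightarrow> (\<lambda>x. D x b) \<in> X"
      using step[OF Suc.prems] by blast
    have "frechet_derivative g (at x) v = (\<Sum>b\<in>Basis. (v \<bullet> b) *\<^sub>R D x b)" for x v
    proof -
      interpret linear "D x" using D(1) by (rule has_derivative_linear)
      have "frechet_derivative g (at x) v = D x v" using D(1) frechet_derivative_at by metis
      also have "\<dots> = D x (\<Sum>b\<in>Basis. (v \<bullet> b) *\<^sub>R b)" by (simp add: euclidean_representation)
      finally show ?thesis by (simp add: sum scale)
    qed
    moreover have "times_differentiable k (\<lambda>x. \<Sum>b\<in>Basis. (v \<bullet> b) *\<^sub>R D x b)" for v
      by (intro times_differentiable_sum times_differentiable_scaleR Suc.IH D) auto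
    moreover have "g differentiable at x" for x using D(1) by (auto simp: differentiable_def)
    ultimately show ?case by simp
  qed
  with assms(1) show ?thesis by (auto simp: smooth_def)
qed

lemma smooth_differentiable: "smooth f \<Longrightarrow> f differentiable at x"
  unfolding smooth_def by (metis times_differentiable.simps(2))

lemma smooth_frechet_derivative: "smooth f \<Longrightarrow> smooth (\<lambda>x. frechet_derivative f (at x) v)"
  unfolding smooth_def by (metis times_differentiable.simps(2))

lemma smooth_continuous_on: "smooth f \<Longrightarrow> continuous_on S f"
  unfolding smooth_def
  by (metis times_differentiable.simps(1) continuous_on_subset subset_UNIV)

text \<open>Polynomial decay is asked of the members of \<open>X\<close> themselves, with no
  derivatives: every iterated derivative of \<open>\<psi>\<close> is again a member, so the bounds
  for all \<open>k\<close> and \<open>n\<close> follow.\<close>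

lemma schwartz_coinduct:
  assumes "\<psi> \<in> X"
    and step: "\<And>g. g \<in> X \<Longrightarrow> \<exists>g'\<in>X. \<forall>t. (g has_vector_derivative g' t) (at t)"
    and bounded: "\<And>g k. g \<in> X \<Longrightarrow> bounded (range (\<lambda>t. t ^ k *\<^sub>R g t))"
  shows "\<psi> \<in> schwartz"
proof -
  have "smooth \<psi>"
  proof (rule smooth_coinduct[OF assms(1)])
    fix g assume "g \<in> X"
    then obtain g' where "g' \<in> X" "\<And>t. (g has_vector_derivative g' t) (at t)" using step by blast
    then show "\<exists>D. (\<forall>x. (g has_derivative D x) (at x)) \<and> (\<forall>b\<in>Basis. (\<lambda>x. D x b) \<in> X)"
      by (intro exI[of _ "\<lambda>x v. v *\<^sub>R g' x"]) (auto simp: has_vector_derivative_def)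
  qed
  moreover have "nth_vector_deriv n \<psi> \<in> X" for n
  proof (induction n)
    case (Suc n)
    obtain g' where "g' \<in> X" "\<And>t. (nth_vector_deriv n \<psi> has_vector_derivative g' t) (at t)"
      using step[OF Suc] by blast
    then have "nth_vector_deriv (Suc n) \<psi> = g'"
      by (simp add: nth_vector_deriv_def vector_derivative_at fun_eq_iff)
    with \<open>g' \<in> X\<close> show ?case by simp
  qed (simp add: nth_vector_deriv_def assms)
  ultimately show ?thesis using bounded by (simp add: schwartz_def)
qed

lemma schwartz_bounded: "\<psi> \<in> schwartz \<Longrightarrow> bounded (range (\<lambda>t. t ^ k *\<^sub>R \<psi> t))"
  by (auto simp: schwartz_def nth_vector_deriv_def dest!: spec2[of _ k "0::nat"])

lemma schwartz_has_vector_derivative: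
  assumes "\<psi> \<in> schwartz"
  shows "(\<psi> has_vector_derivative vector_derivative \<psi> (at t)) (at t)"
  using assms smooth_differentiable by (auto simp: schwartz_def vector_derivative_works[symmetric])

lemma schwartz_vector_derivative:
  assumes "\<psi> \<in> schwartz"
  shows "(\<lambda>t. vector_derivative \<psi> (at t)) \<in> schwartz"
proof -
  have "frechet_derivative \<psi> (at t) 1 = vector_derivative \<psi> (at t)" for t
    using frechet_derivative_at[OF schwartz_has_vector_derivative[OF assms, unfolded has_vector_derivative_def]]
    by (metis scaleR_one)
  then have "smooth (\<lambda>t. vector_derivative \<psi> (at t))"
    using smooth_frechet_derivative[of \<psi> 1] assms by (simp add: schwartz_def)
  moreover have "nth_vector_deriv n (\<lambda>t. vector_derivative \<psi> (at t)) = nth_vector_deriv (Suc n) \<psi>" for n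
    by (simp add: nth_vector_deriv_def funpow_Suc_right del: funpow.simps)
  ultimately show ?thesis
    using assms unfolding schwartz_def by simp
qed

lemma schwartz_lincomb:
  assumes "\<phi> \<in> schwartz" "\<psi> \<in> schwartz"
  shows "(\<lambda>t. a * \<phi> t + b * \<psi> t) \<in> schwartz"
proof (rule schwartz_coinduct[where X = "{\<lambda>t. a * \<phi> t + b * \<psi> t | \<phi> \<psi>. \<phi> \<in> schwartz \<and> \<psi> \<in> schwartz}"])
  fix g assume "g \<in> {\<lambda>t. a * \<phi> t + b * \<psi> t | \<phi> \<psi>. \<phi> \<in> schwartz \<and> \<psi> \<in> schwartz}"
  then obtain \<phi> \<psi> where g: "g = (\<lambda>t. a * \<phi> t + b * \<psi> t)" and *: "\<phi> \<in> schwartz" "\<psi> \<in> schwartz" by auto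
  show "\<exists>g'\<in>{\<lambda>t. a * \<phi> t + b * \<psi> t | \<phi> \<psi>. \<phi> \<in> schwartz \<and> \<psi> \<in> schwartz}.
      \<forall>t. (g has_vector_derivative g' t) (at t)"
  proof (intro bexI allI)
    show "(g has_vector_derivative (\<lambda>t. a * vector_derivative \<phi> (at t) + b * vector_derivative \<psi> (at t)) t) (at t)" for t
      unfolding g
      by (intro has_vector_derivative_add has_vector_derivative_mult_right schwartz_has_vector_derivative *)
  qed (use schwartz_vector_derivative[OF *(1)] schwartz_vector_derivative[OF *(2)] in \<open>intro CollectI exI[of _ "\<lambda>t. vector_derivative \<phi> (at t)"] exI[of _ "\<lambda>t. vector_derivative \<psi> (at t)"] conjI refl\<close>)
  show "bounded (range (\<lambda>t. t ^ k *\<^sub>R g t))" for k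
  proof -
    obtain B where B: "norm (t ^ k *\<^sub>R \<phi> t) \<le> B" for t
      using schwartz_bounded[OF *(1), of k] by (auto simp: bounded_iff)
    obtain C where C: "norm (t ^ k *\<^sub>R \<psi> t) \<le> C" for t
      using schwartz_bounded[OF *(2), of k] by (auto simp: bounded_iff)
    have "norm (t ^ k *\<^sub>R g t) \<le> norm a * B + norm b * C" for t
    proof -
      have "t ^ k *\<^sub>R g t = a * (t ^ k *\<^sub>R \<phi> t) + b * (t ^ k *\<^sub>R \<psi> t)"
        by (simp add: g scaleR_add_right)
      also have "norm \<dots> \<le> norm (a * (t ^ k *\<^sub>R \<phi> t)) + norm (b * (t ^ k *\<^sub>R \<psi> t))"
        by (rule norm_triangle_ineq)
      also have "\<dots> \<le> norm a * B + norm b * C"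
        unfolding norm_mult[of a] norm_mult[of b] by (intro add_mono mult_left_mono B C) auto
      finally show ?thesis .
    qed
    then show ?thesis by (auto simp: bounded_iff)
  qed
qed (use assms in \<open>intro CollectI exI[of _ \<phi>] exI[of _ \<psi>] conjI refl\<close>)

lemma schwartz_cmult: "\<psi> \<in> schwartz \<Longrightarrow> (\<lambda>t. a * \<psi> t) \<in> schwartz"
  using schwartz_lincomb[of \<psi> \<psi> a 0] by simp

text \<open>The exponential stays fixed while \<open>\<psi>\<close> varies over the class:
  differentiation replaces \<open>\<psi>\<close> by 2\<pi>ib\<open>\<psi>\<close> plus its
  derivative. The exponential has modulus 1, so the decay is that of \<open>\<psi>\<close>.\<close>

lemma schwartz_modulate:
  fixes b :: real
  assumes "\<psi> \<in> schwartz"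
  shows "(\<lambda>t. exp (2 * pi * \<i> * b * complex_of_real t) * \<psi> t) \<in> schwartz"
proof (rule schwartz_coinduct[where X = "{\<lambda>t. exp (2 * pi * \<i> * b * complex_of_real t) * \<psi> t | \<psi>. \<psi> \<in> schwartz}"])
  fix g assume "g \<in> {\<lambda>t. exp (2 * pi * \<i> * b * complex_of_real t) * \<psi> t | \<psi>. \<psi> \<in> schwartz}"
  then obtain \<psi> where g: "g = (\<lambda>t. exp (2 * pi * \<i> * b * complex_of_real t) * \<psi> t)" and *: "\<psi> \<in> schwartz" by auto
  \<comment> \<open>The factor \<open>1\<close> brings the second summand into the form expected by
    \<open>schwartz_lincomb\<close>.\<close>
  let ?L = "\<lambda>t. 2 * pi * \<i> * b * \<psi> t + 1 * vector_derivative \<psi> (at t)"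
  show "\<exists>g'\<in>{\<lambda>t. exp (2 * pi * \<i> * b * complex_of_real t) * \<psi> t | \<psi>. \<psi> \<in> schwartz}.
      \<forall>t. (g has_vector_derivative g' t) (at t)"
  proof (intro bexI allI)
    have e: "((\<lambda>t. exp (2 * pi * \<i> * b * complex_of_real t)) has_vector_derivative
          2 * pi * \<i> * b * exp (2 * pi * \<i> * b * complex_of_real t)) (at t)" for t
      by (rule has_vector_derivative_real_field)
         (auto intro!: derivative_eq_intros)
    show "(g has_vector_derivative (\<lambda>t. exp (2 * pi * \<i> * b * complex_of_real t) * ?L t) t) (at t)" for t
      using has_vector_derivative_mult[OF e schwartz_has_vector_derivative[OF *], of t]
      by (simp add: g algebra_simps)
    have "?L \<in> schwartz" by (intro schwartz_lincomb schwartz_vector_derivative *)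
    then show "(\<lambda>t. exp (2 * pi * \<i> * b * complex_of_real t) * ?L t) \<in>
        {\<lambda>t. exp (2 * pi * \<i> * b * complex_of_real t) * \<psi> t | \<psi>. \<psi> \<in> schwartz}"
      by (intro CollectI exI[of _ ?L] conjI refl)
  qed
  show "bounded (range (\<lambda>t. t ^ k *\<^sub>R g t))" for k
    using schwartz_bounded[OF *, of k] by (auto simp: bounded_iff g norm_mult)
qed (use assms in \<open>intro CollectI exI[of _ \<psi>] conjI refl\<close>)

text \<open>A sum is at most twice its larger summand. This replaces the binomial formula whenever a
  polynomial weight has to be moved from one variable to a translate or multiple of it.\<close>

lemma power_le_two_power_add:
  fixes x y z :: real
  assumes "0 \<le> z" "z \<le> x + y" "0 \<le> x" "0 \<le> y"
  shows "z ^ k \<le> 2 ^ k * (x ^ k + y ^ k)"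
proof -
  have "z ^ k \<le> (2 * max x y) ^ k" using assms by (intro power_mono) (auto simp: max_def)
  also have "\<dots> \<le> 2 ^ k * (x ^ k + y ^ k)"
    using assms by (auto simp: power_mult_distrib max_def)
  finally show ?thesis .
qed

lemma schwartz_translate:
  assumes "\<psi> \<in> schwartz"
  shows "(\<lambda>t. \<psi> (t - a)) \<in> schwartz"
proof (rule schwartz_coinduct[where X = "{\<lambda>t. \<psi> (t - a) | \<psi>. \<psi> \<in> schwartz}"])
  fix g assume "g \<in> {\<lambda>t. \<psi> (t - a) | \<psi>. \<psi> \<in> schwartz}"
  then obtain \<psi> where g: "g = (\<lambda>t. \<psi> (t - a))" and *: "\<psi> \<in> schwartz" by auto
  show "\<exists>g'\<in>{\<lambda>t. \<psi> (t - a) | \<psi>. \<psi> \<in> schwartz}. \<forall>t. (g has_vector_derivative g' t) (at t)"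
  proof (intro bexI allI)
    show "(g has_vector_derivative (\<lambda>t. (\<lambda>t. vector_derivative \<psi> (at t)) (t - a)) t) (at t)" for t
    proof -
      have "((\<lambda>t. t - a) has_vector_derivative 1) (at t)"
        by (auto intro!: derivative_eq_intros)
      from vector_diff_chain_at[OF this schwartz_has_vector_derivative[OF *]]
      show ?thesis by (simp add: g o_def)
    qed
  qed (use schwartz_vector_derivative[OF *] in \<open>intro CollectI exI[of _ "\<lambda>t. vector_derivative \<psi> (at t)"] conjI refl\<close>)
  show "bounded (range (\<lambda>t. t ^ k *\<^sub>R g t))" for k
  proof -
    obtain B where B: "norm (t ^ k *\<^sub>R \<psi> t) \<le> B" for t
      using schwartz_bounded[OF *, of k] by (auto simp: bounded_iff)
    obtain C where C: "norm (t ^ 0 *\<^sub>R \<psi> t) \<le> C" for t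
      using schwartz_bounded[OF *, of 0] by (auto simp: bounded_iff)
    have "norm (t ^ k *\<^sub>R g t) \<le> 2 ^ k * (B + \<bar>a\<bar> ^ k * C)" for t
    proof -
      have "\<bar>t\<bar> ^ k \<le> 2 ^ k * (\<bar>t - a\<bar> ^ k + \<bar>a\<bar> ^ k)"
        using abs_triangle_ineq[of "t - a" a] by (intro power_le_two_power_add) auto
      then have "\<bar>t\<bar> ^ k * norm (\<psi> (t - a)) \<le> 2 ^ k * (\<bar>t - a\<bar> ^ k + \<bar>a\<bar> ^ k) * norm (\<psi> (t - a))"
        by (rule mult_right_mono) simp
      also have "\<dots> = 2 ^ k * (\<bar>t - a\<bar> ^ k * norm (\<psi> (t - a)) + \<bar>a\<bar> ^ k * norm (\<psi> (t - a)))"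
        by (simp add: algebra_simps)
      also have "\<dots> \<le> 2 ^ k * (B + \<bar>a\<bar> ^ k * C)"
        using B[of "t - a"] C[of "t - a"] by (intro mult_left_mono add_mono) (auto simp: power_abs)
      finally show ?thesis by (simp add: g power_abs)
    qed
    then show ?thesis by (auto simp: bounded_iff)
  qed
qed (use assms in \<open>intro CollectI exI[of _ \<psi>] conjI refl\<close>)

section \<open>Fourier series\<close>

definition fourier_mode :: "int \<Rightarrow> real \<Rightarrow> complex" where
  "fourier_mode n x = exp (2 * pi * \<i> * of_int n * complex_of_real x)"

definition fourier_coeff :: "(real \<Rightarrow> complex) \<Rightarrow> int \<Rightarrow> complex" where
  "fourier_coeff g n = integral {0..1} (\<lambda>x. fourier_mode (- n) x * g x)"

lemma fourier_mode_add: "fourier_mode (m + n) x = fourier_mode m x * fourier_mode n x"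
  by (simp add: fourier_mode_def exp_add[symmetric] algebra_simps)

lemma fourier_mode_add_right: "fourier_mode n (x + y) = fourier_mode n x * fourier_mode n y"
  by (simp add: fourier_mode_def exp_add[symmetric] algebra_simps)

lemma fourier_mode_0 [simp]: "fourier_mode 0 x = 1" "fourier_mode n 0 = 1"
  by (simp_all add: fourier_mode_def)

lemma fourier_mode_minus_right: "fourier_mode n (- x) = fourier_mode (- n) x"
  by (simp add: fourier_mode_def)

lemma norm_fourier_mode [simp]: "norm (fourier_mode n x) = 1"
  by (simp add: fourier_mode_def norm_exp_eq_Re)

lemma cnj_fourier_mode: "cnj (fourier_mode n x) = fourier_mode (- n) x"
  by (simp add: fourier_mode_def exp_cnj)

lemma fourier_mode_of_int [simp]: "fourier_mode n (of_int k) = 1"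
  by (auto simp: fourier_mode_def exp_eq_1 intro!: exI[of _ "n * k"])

lemma fourier_mode_1_right [simp]: "fourier_mode n 1 = 1"
  using fourier_mode_of_int[of n 1] by simp

lemma fourier_mode_has_vector_derivative:
  "(fourier_mode n has_vector_derivative 2 * pi * \<i> * of_int n * fourier_mode n x) (at x within S)"
  unfolding fourier_mode_def[abs_def]
  by (rule has_vector_derivative_real_field) (auto intro!: derivative_eq_intros)

lemma continuous_on_fourier_mode [continuous_intros]:
  "continuous_on S f \<Longrightarrow> continuous_on S (\<lambda>x. fourier_mode n (f x))"
  unfolding fourier_mode_def by (intro continuous_intros)

lemma has_integral_fourier_mode:
  "(fourier_mode n has_integral (if n = 0 then 1 else 0)) {0..1}"
proof (cases "n = 0")
  case True
  have "((\<lambda>x::real. 1::complex) has_integral 1) {0..1}" using has_integral_const_real[of "1::complex" 0 1] by simp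
  moreover have "fourier_mode 0 = (\<lambda>x. 1)" by (simp add: fun_eq_iff)
  ultimately show ?thesis using True by simp
next
  case False
  have "((\<lambda>x. 2 * pi * \<i> * of_int n * fourier_mode n x) has_integral
      (fourier_mode n 1 - fourier_mode n 0)) {0..1}"
    by (intro fundamental_theorem_of_calculus fourier_mode_has_vector_derivative) auto
  from has_integral_mult_right[OF this, of "1 / (2 * pi * \<i> * of_int n)"] False
  show ?thesis by simp
qed

lemma has_integral_fourier_coeff:
  assumes "continuous_on {0..1} g"
  shows "((\<lambda>x. fourier_mode (- n) x * g x) has_integral fourier_coeff g n) {0..1}"
  unfolding fourier_coeff_def
  by (intro integrable_integral integrable_continuous_interval continuous_intros assms)

section \<open>Bessel's inequality and the Riemann-Lebesgue lemma\<close>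

lemma norm_fourier_coeff_le:
  assumes "continuous_on {0..1} g" "\<And>x. x \<in> {0..1} \<Longrightarrow> norm (g x) \<le> B"
  shows "norm (fourier_coeff g n) \<le> B"
proof -
  have "norm (integral (cbox 0 1) (\<lambda>x. fourier_mode (- n) x * g x)) \<le> B * Henstock_Kurzweil_Integration.content (cbox 0 (1::real))"
    using assms norm_ge_zero[of "g 0"]
    by (intro has_integral_bound[OF _ integrable_integral] integrable_continuous continuous_intros)
       (auto simp: norm_mult simp del: norm_ge_zero intro: order_trans)
  then show ?thesis by (simp add: fourier_coeff_def)
qed

text \<open>With \<open>P\<close> the partial sum over \<open>A\<close>, integrate the nonnegative
  function |h - P|^2. By orthonormality of the modes the integrals of h times cnj P and of |P|^2
  both equal \<open>?S\<close>, so the total is the integral of |h|^2 minus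
  \<open>?S\<close>.\<close>

lemma Bessel_inequality:
  assumes cont: "continuous_on {0..1} h" and fin: "finite A"
  shows "(\<Sum>n\<in>A. (norm (fourier_coeff h n))\<^sup>2) \<le> integral {0..1} (\<lambda>x. (norm (h x))\<^sup>2)"
proof -
  let ?c = "fourier_coeff h"
  let ?S = "\<Sum>n\<in>A. (norm (?c n))\<^sup>2"
  define P where "P x = (\<Sum>n\<in>A. ?c n * fourier_mode n x)" for x
  have "((\<lambda>x. \<Sum>n\<in>A. cnj (?c n) * (fourier_mode (- n) x * h x)) has_integral
      (\<Sum>n\<in>A. cnj (?c n) * ?c n)) {0..1}"
    by (intro has_integral_sum has_integral_mult_right has_integral_fourier_coeff fin cont)
  also have "(\<lambda>x. \<Sum>n\<in>A. cnj (?c n) * (fourier_mode (- n) x * h x)) = (\<lambda>x. h x * cnj (P x))"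
    by (simp add: P_def cnj_fourier_mode sum_distrib_left mult_ac)
  also have "(\<Sum>n\<in>A. cnj (?c n) * ?c n) = complex_of_real ?S"
    by (simp add: complex_norm_square mult.commute del: of_real_power)
  finally have hP: "((\<lambda>x. h x * cnj (P x)) has_integral complex_of_real ?S) {0..1}" .
  have "((\<lambda>x. \<Sum>n\<in>A. \<Sum>m\<in>A. ?c n * cnj (?c m) * fourier_mode (n - m) x) has_integral
      (\<Sum>n\<in>A. \<Sum>m\<in>A. ?c n * cnj (?c m) * (if n - m = 0 then 1 else 0))) {0..1}"
    by (intro has_integral_sum has_integral_mult_right has_integral_fourier_mode fin)
  also have "(\<lambda>x. \<Sum>n\<in>A. \<Sum>m\<in>A. ?c n * cnj (?c m) * fourier_mode (n - m) x) = (\<lambda>x. P x * cnj (P x))"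
    using fourier_mode_add[of _ "- _"]
    by (simp add: P_def cnj_fourier_mode sum_product mult_ac)
  also have "(\<Sum>n\<in>A. \<Sum>m\<in>A. ?c n * cnj (?c m) * (if n - m = 0 then 1 else 0)) = complex_of_real ?S"
    using fin by (simp add: complex_norm_square if_distrib[of "\<lambda>x. _ * x"] cong: if_cong del: of_real_power)
  finally have PP: "((\<lambda>x. P x * cnj (P x)) has_integral complex_of_real ?S) {0..1}" .
  have hh: "((\<lambda>x. (norm (h x))\<^sup>2) has_integral integral {0..1} (\<lambda>x. (norm (h x))\<^sup>2)) {0..1}"
    by (intro integrable_integral integrable_continuous_interval continuous_intros cont)
  have Re: "(f has_integral I) {0..1} \<Longrightarrow> ((\<lambda>x. Re (f x)) has_integral Re I) {0..1}" for f :: "real \<Rightarrow> complex" and I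
    using has_integral_linear[OF _ bounded_linear_Re] by (simp add: o_def)
  have int: "((\<lambda>x. (norm (h x))\<^sup>2 - 2 * Re (h x * cnj (P x)) + Re (P x * cnj (P x))) has_integral
      (integral {0..1} (\<lambda>x. (norm (h x))\<^sup>2) - 2 * Re (complex_of_real ?S) + Re (complex_of_real ?S))) {0..1}"
    by (intro has_integral_add has_integral_diff has_integral_mult_right hh Re hP PP)
  have "(norm (h x))\<^sup>2 - 2 * Re (h x * cnj (P x)) + Re (P x * cnj (P x)) \<ge> 0" for x
  proof -
    have "(norm (h x))\<^sup>2 - 2 * Re (h x * cnj (P x)) + Re (P x * cnj (P x)) = (norm (h x - P x))\<^sup>2"
      unfolding cmod_power2 by (simp add: power2_eq_square algebra_simps)
    then show ?thesis by simp
  qed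
  from has_integral_nonneg[OF int this] show ?thesis by simp
qed

text \<open>The Riemann-Lebesgue lemma in the form needed for telescoped boundary terms: Bessel
  bounds the partial sums of squares along \<open>k\<close>, and injectivity makes each of them a
  sum over a set of frequencies without repetition.\<close>

lemma fourier_coeff_tendsto_0:
  assumes "continuous_on {0..1} h" "inj k"
  shows "(\<lambda>N::nat. fourier_coeff h (k N)) \<longlonglongrightarrow> 0"
proof -
  have "summable (\<lambda>N. (norm (fourier_coeff h (k N)))\<^sup>2)"
  proof (rule bounded_imp_summable)
    fix N
    have "(\<Sum>i\<le>N. (norm (fourier_coeff h (k i)))\<^sup>2) = (\<Sum>n\<in>k ` {..N}. (norm (fourier_coeff h n))\<^sup>2)"
      using assms(2) by (simp add: sum.reindex inj_on_subset o_def)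
    also have "\<dots> \<le> integral {0..1} (\<lambda>x. (norm (h x))\<^sup>2)"
      by (rule Bessel_inequality) (use assms in auto)
    finally show "(\<Sum>i\<le>N. (norm (fourier_coeff h (k i)))\<^sup>2) \<le> integral {0..1} (\<lambda>x. (norm (h x))\<^sup>2)" .
  qed auto
  from tendsto_real_sqrt[OF summable_LIMSEQ_zero[OF this]] show ?thesis
    by (simp add: tendsto_norm_zero_iff)
qed

section \<open>Pointwise inversion and uniqueness of Fourier series\<close>

lemma has_vector_derivative_imp_tendsto:
  assumes "(f has_vector_derivative D) (at x)"
  shows "((\<lambda>y. (f y - f x) /\<^sub>R (y - x)) \<longlongrightarrow> D) (at x)"
proof -
  have "((\<lambda>y. norm ((f y - f x - (y - x) *\<^sub>R D) /\<^sub>R norm (y - x))) \<longlongrightarrow> 0) (at x)"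
    using assms by (intro tendsto_norm_zero)
      (simp add: has_vector_derivative_def has_derivative_at_within)
  then have "((\<lambda>y. norm ((f y - f x) /\<^sub>R (y - x) - D)) \<longlongrightarrow> 0) (at x)"
  proof (rule Lim_transform_eventually)
    show "\<forall>\<^sub>F y in at x. norm ((f y - f x - (y - x) *\<^sub>R D) /\<^sub>R norm (y - x)) =
        norm ((f y - f x) /\<^sub>R (y - x) - D)"
      unfolding eventually_at_filter
    proof (intro always_eventually allI impI)
      fix y assume "y \<noteq> x"
      then have "(f y - f x) /\<^sub>R (y - x) - D = (f y - f x - (y - x) *\<^sub>R D) /\<^sub>R (y - x)"
        by (simp add: scaleR_diff_right)
      then show "norm ((f y - f x - (y - x) *\<^sub>R D) /\<^sub>R norm (y - x)) = norm ((f y - f x) /\<^sub>R (y - x) - D)"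
        by simp
    qed
  qed
  then show ?thesis by (simp add: tendsto_norm_zero_iff LIM_zero_iff)
qed

lemma periodic_of_int:
  assumes "\<And>x. g (x + 1) = g x"
  shows "g (x + of_int k) = g (x :: real)"
proof (induction k rule: int_induct[of _ 0])
  case (step1 i)
  then show ?case using assms[of "x + of_int i"] by (simp add: add_ac)
next
  case (step2 i)
  then show ?case using assms[of "x + of_int (i - 1)"] by (simp add: add_ac)
qed simp

lemma fourier_mode_1_eq_1: "fourier_mode 1 x = 1 \<Longrightarrow> x \<in> \<int>"
  by (auto simp: fourier_mode_def exp_eq_1)

text \<open>Chernoff's argument: dividing \<^term>\<open>g x - g x0\<close> by \<^term>\<open>fourier_mode 1 (x - x0) - 1\<close> makes the
  partial sums of the Fourier series telescope.\<close>

lemma fourier_series_telescope: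
  assumes deriv: "\<And>x. (g has_vector_derivative g' x) (at x)" and cont: "continuous_on UNIV g'"
    and per: "\<And>x. g (x + 1) = g x"
  obtains h where "continuous_on {0..1} h" and
    "\<And>n. fourier_coeff g n * fourier_mode n x0 = (if n = 0 then g x0 else 0) +
      fourier_coeff h (n - 1) * fourier_mode (n - 1) x0 - fourier_coeff h n * fourier_mode n x0"
proof -
  define e where "e x = fourier_mode 1 (x - x0) - 1" for x
  \<comment> \<open>\<open>e\<close> vanishes exactly on the integer translates of
    \<open>x0\<close>, where \<open>g x - g x0\<close> vanishes too by periodicity. At these points
    \<open>e\<close> has derivative 2\<pi>i, so the first branch is the limit of the second.\<close>
  define h where "h x = (if e x = 0 then g' x / (2 * pi * \<i>) else (g x - g x0) / e x)" for x
  have e': "(e has_vector_derivative 2 * pi * \<i> * fourier_mode 1 (x - x0)) (at x)" for x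
  proof -
    have "e = (\<lambda>x. fourier_mode 1 x * fourier_mode 1 (- x0) - 1)"
      using fourier_mode_add_right[of 1 _ "- x0"] by (auto simp: e_def)
    moreover have "((\<lambda>x. fourier_mode 1 x * fourier_mode 1 (- x0) - 1) has_vector_derivative
        2 * pi * \<i> * of_int 1 * fourier_mode 1 x * fourier_mode 1 (- x0) - 0) (at x)"
      by (intro has_vector_derivative_diff has_vector_derivative_mult_left
          fourier_mode_has_vector_derivative has_vector_derivative_const)
    ultimately show ?thesis
      using fourier_mode_add_right[of 1 x "- x0"] by (simp add: mult.assoc)
  qed
  have zero: "g b = g x0" if "e b = 0" for b
  proof -
    from that have "b - x0 \<in> \<int>" unfolding e_def by (intro fourier_mode_1_eq_1) simp
    then obtain k where "b = x0 + of_int k" by (metis Ints_cases add_diff_cancel_left' diff_add_cancel add.commute)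
    then show ?thesis using periodic_of_int[of g, OF per] by simp
  qed
  have conte: "isCont e x" for x using e' has_vector_derivative_continuous by blast
  have contg: "isCont g x" for x using deriv has_vector_derivative_continuous by blast
  have "isCont h b" for b
  proof (cases "e b = 0")
    case False
    then have "\<forall>\<^sub>F x in nhds b. e x \<noteq> 0"
      using tendsto_imp_eventually_ne[OF isContD[OF conte[of b]]]
      by (simp add: eventually_nhds_conv_at)
    then have "\<forall>\<^sub>F x in nhds b. h x = (g x - g x0) / e x"
      by eventually_elim (simp add: h_def)
    then have "isCont h b \<longleftrightarrow> isCont (\<lambda>x. (g x - g x0) / e x) b" by (rule isCont_cong)
    then show ?thesis using False contg conte by (auto intro!: continuous_intros)
  next
    case True
    then have fm: "fourier_mode 1 (b - x0) = 1" by (simp add: e_def)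
    have le: "((\<lambda>y. (e y - e b) /\<^sub>R (y - b)) \<longlongrightarrow> 2 * pi * \<i>) (at b)"
      using has_vector_derivative_imp_tendsto[OF e'[of b]] by (simp add: fm)
    have "((\<lambda>y. ((g y - g b) /\<^sub>R (y - b)) / ((e y - e b) /\<^sub>R (y - b))) \<longlongrightarrow> g' b / (2 * pi * \<i>)) (at b)"
      by (intro tendsto_divide has_vector_derivative_imp_tendsto deriv le) simp
    moreover have "\<forall>\<^sub>F y in at b. ((g y - g b) /\<^sub>R (y - b)) / ((e y - e b) /\<^sub>R (y - b)) = h y"
    proof -
      \<comment> \<open>The nonzero limit 2\<pi>i isolates the zero \<open>b\<close> of
        \<open>e\<close>: close to \<open>b\<close>, but off it, \<open>h\<close> is given by its
        second branch.\<close>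
      have "\<forall>\<^sub>F y in at b. (e y - e b) /\<^sub>R (y - b) \<noteq> 0"
        by (rule tendsto_imp_eventually_ne[OF le]) simp
      then show ?thesis
        by eventually_elim (use True zero[OF True] in \<open>auto simp: h_def scaleR_conv_of_real divide_simps\<close>)
    qed
    ultimately have "(h \<longlongrightarrow> g' b / (2 * pi * \<i>)) (at b)" by (rule Lim_transform_eventually)
    then show ?thesis using True by (simp add: isCont_def h_def)
  qed
  then have conth: "continuous_on {0..1} h" by (simp add: continuous_at_imp_continuous_on)
  have gh: "g x = g x0 + h x * (fourier_mode 1 (x - x0) - 1)" for x
    using zero[of x] by (auto simp: h_def e_def)
  have *: "fourier_coeff g n = (if n = 0 then g x0 else 0) +
      fourier_mode (- 1) x0 * fourier_coeff h (n - 1) - fourier_coeff h n" for n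
  proof -
    \<comment> \<open>Multiplication by \<open>fourier_mode 1 (x - x0)\<close> lowers the frequency
      paired with \<open>h\<close> from \<open>n\<close> to \<open>n - 1\<close>, at the cost of a
      factor depending on \<open>x0\<close>. This gives the two neighbouring coefficients of
      \<open>h\<close>.\<close>
    have eq: "fourier_mode (- n) x * g x = g x0 * fourier_mode (- n) x +
        fourier_mode (- 1) x0 * (fourier_mode (- (n - 1)) x * h x) - fourier_mode (- n) x * h x" for x
      unfolding gh[of x]
      using fourier_mode_add_right[of 1 x "- x0"] fourier_mode_add[of "- n" 1 x]
      by (simp add: algebra_simps fourier_mode_minus_right)
    have "((\<lambda>x. g x0 * fourier_mode (- n) x +
        fourier_mode (- 1) x0 * (fourier_mode (- (n - 1)) x * h x) - fourier_mode (- n) x * h x) has_integral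
        g x0 * (if - n = 0 then 1 else 0) + fourier_mode (- 1) x0 * fourier_coeff h (n - 1) - fourier_coeff h n) {0..1}"
      by (intro has_integral_add has_integral_diff has_integral_mult_right
          has_integral_fourier_mode has_integral_fourier_coeff conth)
    from integral_unique[OF this] show ?thesis unfolding fourier_coeff_def[of g] eq by simp
  qed
  show ?thesis
  proof (rule that[OF conth])
    show "fourier_coeff g n * fourier_mode n x0 = (if n = 0 then g x0 else 0) +
      fourier_coeff h (n - 1) * fourier_mode (n - 1) x0 - fourier_coeff h n * fourier_mode n x0" for n
      using fourier_mode_add[of "- 1" n x0] unfolding * by (simp add: algebra_simps)
  qed
qed

text \<open>The symmetric partial sums telescope to \<open>g x\<close> plus two boundary terms,
  which tend to 0 by Riemann-Lebesgue. Absolute summability provides an unordered sum, and the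
  symmetric limit determines its value.\<close>

lemma fourier_inversion:
  assumes deriv: "\<And>x. (g has_vector_derivative g' x) (at x)" and cont: "continuous_on UNIV g'"
    and per: "\<And>x. g (x + 1) = g x"
    and sum: "(\<lambda>n. norm (fourier_coeff g n)) summable_on UNIV"
  shows "((\<lambda>n. fourier_coeff g n * fourier_mode n x) has_sum g x) UNIV"
proof -
  obtain h where conth: "continuous_on {0..1} h" and tel: "\<And>n. fourier_coeff g n * fourier_mode n x =
      (if n = 0 then g x else 0) + fourier_coeff h (n - 1) * fourier_mode (n - 1) x
      - fourier_coeff h n * fourier_mode n x"
    using fourier_series_telescope[OF deriv cont per] by metis
  have partial: "(\<Sum>n\<in>{- int N..int N}. fourier_coeff g n * fourier_mode n x) =
      g x + fourier_coeff h (- int N - 1) * fourier_mode (- int N - 1) x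
      - fourier_coeff h (int N) * fourier_mode (int N) x" for N
  proof (induction N)
    case (Suc N)
    have "{- int (Suc N)..int (Suc N)} = insert (- int N - 1) (insert (int N + 1) {- int N..int N})" by auto
    then have "(\<Sum>n\<in>{- int (Suc N)..int (Suc N)}. fourier_coeff g n * fourier_mode n x) =
        fourier_coeff g (- int N - 1) * fourier_mode (- int N - 1) x +
        (fourier_coeff g (int N + 1) * fourier_mode (int N + 1) x +
        (\<Sum>n\<in>{- int N..int N}. fourier_coeff g n * fourier_mode n x))"
      by simp
    then show ?case unfolding Suc tel[of "int N + 1"] tel[of "- int N - 1"] by (simp add: add.commute)
  qed (use tel[of 0] in simp)
  have small: "(\<lambda>N. fourier_coeff h (k N) * fourier_mode (k N) x) \<longlonglongrightarrow> 0" if "inj k" for k :: "nat \<Rightarrow> int"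
  proof (rule tendsto_norm_zero_cancel)
    show "(\<lambda>N. norm (fourier_coeff h (k N) * fourier_mode (k N) x)) \<longlonglongrightarrow> 0"
      using tendsto_norm_zero[OF fourier_coeff_tendsto_0[OF conth that]] by (simp add: norm_mult)
  qed
  have "(\<lambda>N. \<Sum>n\<in>{- int N..int N}. fourier_coeff g n * fourier_mode n x) \<longlonglongrightarrow> g x + 0 - 0"
    unfolding partial by (intro tendsto_intros small) (auto simp: inj_def)
  moreover have "(\<lambda>n. fourier_coeff g n * fourier_mode n x) summable_on UNIV"
    using sum by (simp add: norm_mult summable_on_iff_abs_summable_on_complex)
  then obtain s where s: "((\<lambda>n. fourier_coeff g n * fourier_mode n x) has_sum s) UNIV"
    using summable_on_def by blast
  \<comment> \<open>Symmetric intervals exhaust the integers, so they form a sequence along which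
    the net of all finite partial sums may be evaluated.\<close>
  have "filterlim (\<lambda>N. {- int N..int N}) (finite_subsets_at_top UNIV) sequentially"
    unfolding filterlim_finite_subsets_at_top
  proof safe
    fix X :: "int set" assume "finite X"
    then have "X \<subseteq> {- int N..int N}" if "N \<ge> nat (Max (insert 0 (abs ` X)))" for N
      using that by (force simp: nat_le_iff)
    then show "\<forall>\<^sub>F N in sequentially. finite {- int N..int N} \<and> X \<subseteq> {- int N..int N} \<and> {- int N..int N} \<subseteq> UNIV"
      unfolding eventually_sequentially by blast
  qed
  from filterlim_compose[OF s[unfolded has_sum_def] this]
  have "(\<lambda>N. \<Sum>n\<in>{- int N..int N}. fourier_coeff g n * fourier_mode n x) \<longlonglongrightarrow> s" .
  ultimately have "s = g x" using LIMSEQ_unique by fastforce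
  with s show ?thesis by simp
qed

text \<open>The coefficients are absolutely summable, so the series converges uniformly and may be
  integrated termwise against \<open>fourier_mode (- m)\<close>. By orthogonality the integral of
  the partial sum over \<open>X\<close> equals \<open>c m\<close> as soon as \<open>X\<close>
  contains \<open>m\<close>.\<close>

lemma fourier_coeff_unique:
  assumes F: "\<And>x. ((\<lambda>n. c n * fourier_mode n x) has_sum F x) UNIV"
  shows "fourier_coeff F m = c m"
proof -
  \<comment> \<open>At 0 every mode equals 1, so the series there is that of the coefficients
    themselves.\<close>
  have "c summable_on UNIV" using F[of 0] by (auto simp: summable_on_def)
  then have sum: "(\<lambda>n. norm (c n)) summable_on UNIV" by (simp add: summable_on_iff_abs_summable_on_complex)
  have "uniform_limit {0..1} (\<lambda>X x. \<Sum>n\<in>X. fourier_mode (- m) x * (c n * fourier_mode n x))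
      (\<lambda>x. fourier_mode (- m) x * F x) (finite_subsets_at_top UNIV)"
    by (rule Weierstrass_m_test_general'[OF _ _ sum])
       (auto simp: norm_mult intro: has_sum_cmult_right F)
  then obtain I J where I: "\<And>X. ((\<lambda>x. \<Sum>n\<in>X. fourier_mode (- m) x * (c n * fourier_mode n x)) has_integral I X) {0..1}"
    and J: "((\<lambda>x. fourier_mode (- m) x * F x) has_integral J) {0..1}"
    and lim: "(I \<longlongrightarrow> J) (finite_subsets_at_top UNIV)"
    by (rule uniform_limit_integral) (auto intro!: continuous_intros)
  have "I X = c m" if "finite X" "m \<in> X" for X
  proof -
    have "((\<lambda>x. \<Sum>n\<in>X. c n * fourier_mode (n - m) x) has_integral
        (\<Sum>n\<in>X. c n * (if n - m = 0 then 1 else 0))) {0..1}"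
      by (intro has_integral_sum has_integral_mult_right has_integral_fourier_mode that)
    moreover have "c n * fourier_mode (n - m) x = fourier_mode (- m) x * (c n * fourier_mode n x)" for n x
      using fourier_mode_add[of "- m" n x] by simp
    moreover have "(\<Sum>n\<in>X. c n * (if n - m = 0 then 1 else 0)) = c m"
      using that by (simp add: if_distrib[of "\<lambda>x. _ * x"] cong: if_cong)
    ultimately have "((\<lambda>x. \<Sum>n\<in>X. fourier_mode (- m) x * (c n * fourier_mode n x)) has_integral c m) {0..1}"
      by simp
    with I[of X] show ?thesis by (rule has_integral_unique)
  qed
  then have "\<forall>\<^sub>F X in finite_subsets_at_top UNIV. I X = c m"
    unfolding eventually_finite_subsets_at_top by (intro exI[of _ "{m}"]) auto
  then have "(I \<longlongrightarrow> c m) (finite_subsets_at_top UNIV)" by (rule tendsto_eventually)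
  with lim have "J = c m" using tendsto_unique finite_subsets_at_top_neq_bot by blast
  with J show ?thesis unfolding fourier_coeff_def by (simp add: integral_unique)
qed

section \<open>Series of translated Schwartz functions\<close>

text \<open>Transport along the bijection \<open>int_decode\<close> from the naturals. Since n is at
  most twice |\<open>int_decode n\<close>|, the terms are dominated by those of the series of
  inverse squares, with 4 as the square of this 2.\<close>

lemma summable_on_int_inverse_squares:
  "(\<lambda>n::int. 1 / (1 + \<bar>real_of_int n\<bar>)\<^sup>2) summable_on UNIV"
proof -
  have bound: "1 / (1 + \<bar>real_of_int (int_decode n)\<bar>)\<^sup>2 \<le> 4 * (1 / (real (Suc n))\<^sup>2)" for n
  proof -
    have "int n \<le> 2 * \<bar>int_decode n\<bar>"
      by (auto simp: int_decode_def sum_decode_def elim!: evenE oddE)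
    then have "real n \<le> 2 * \<bar>real_of_int (int_decode n)\<bar>" by linarith
    then have "(real (Suc n))\<^sup>2 \<le> (2 * (1 + \<bar>real_of_int (int_decode n)\<bar>))\<^sup>2"
      by (intro power_mono) auto
    then have "(real (Suc n))\<^sup>2 \<le> 2\<^sup>2 * (1 + \<bar>real_of_int (int_decode n)\<bar>)\<^sup>2"
      by (simp only: power_mult_distrib)
    then show ?thesis by (simp add: divide_simps del: of_nat_Suc)
  qed
  have "summable (\<lambda>n. 4 * (1 / (real (Suc n))\<^sup>2))"
    using inverse_power_summable[of 2, where 'a = real]
    by (intro summable_mult) (simp add: summable_Suc_iff[of "\<lambda>n. 1 / (real n)\<^sup>2"] inverse_eq_divide del: of_nat_Suc)
  then have "summable (\<lambda>n. norm (1 / (1 + \<bar>real_of_int (int_decode n)\<bar>)\<^sup>2))"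
    by (rule summable_comparison_test') (use bound in auto)
  then have "(\<lambda>n. 1 / (1 + \<bar>real_of_int (int_decode n)\<bar>)\<^sup>2) summable_on UNIV"
    by (rule norm_summable_imp_summable_on)
  then show ?thesis
    using summable_on_reindex_bij_betw[OF bij_int_decode, of "\<lambda>n::int. 1 / (1 + \<bar>real_of_int n\<bar>)\<^sup>2"]
    by simp
qed

text \<open>For bounded \<open>y\<close> the point t = y + n\<delta> is far out when
  \<open>n\<close> is large, namely |n| is at most (|t| + R)/\<delta>. A weight in \<open>n\<close>
  is therefore a weight in t up to a constant, and decay in t turns into decay in
  \<open>n\<close>.\<close>

lemma schwartz_decay_on_translates:
  fixes \<delta> R :: real
  assumes \<psi>: "\<psi> \<in> schwartz" and "0 < \<delta>" "0 \<le> R"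
  obtains M where "\<And>(n::int) y. \<bar>y\<bar> \<le> R \<Longrightarrow> (1 + \<bar>real_of_int n\<bar>) ^ j * norm (\<psi> (y + n * \<delta>)) \<le> M"
proof -
  obtain B where B: "norm (t ^ j *\<^sub>R \<psi> t) \<le> B" for t
    using schwartz_bounded[OF \<psi>, of j] by (auto simp: bounded_iff)
  obtain C where C: "norm (t ^ 0 *\<^sub>R \<psi> t) \<le> C" for t
    using schwartz_bounded[OF \<psi>, of 0] by (auto simp: bounded_iff)
  show ?thesis
  proof (rule that)
    fix n :: int and y :: real assume y: "\<bar>y\<bar> \<le> R"
    let ?t = "y + n * \<delta>"
    have "\<bar>real_of_int n\<bar> * \<delta> \<le> \<bar>?t\<bar> + R"
      using y assms(2) abs_triangle_ineq4[of ?t y] by (simp add: abs_mult)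
    then have "\<bar>real_of_int n\<bar> \<le> (\<bar>?t\<bar> + R) / \<delta>"
      using assms(2) by (simp add: pos_le_divide_eq)
    then have "1 + \<bar>real_of_int n\<bar> \<le> \<bar>?t\<bar> / \<delta> + (1 + R / \<delta>)"
      by (simp add: add_divide_distrib)
    then have "(1 + \<bar>real_of_int n\<bar>) ^ j \<le> 2 ^ j * ((\<bar>?t\<bar> / \<delta>) ^ j + (1 + R / \<delta>) ^ j)"
      using assms by (intro power_le_two_power_add) auto
    then have "(1 + \<bar>real_of_int n\<bar>) ^ j * norm (\<psi> ?t) \<le> 2 ^ j * ((\<bar>?t\<bar> / \<delta>) ^ j + (1 + R / \<delta>) ^ j) * norm (\<psi> ?t)"
      by (rule mult_right_mono) simp
    also have "\<dots> = 2 ^ j * (\<bar>?t\<bar> ^ j * norm (\<psi> ?t) / \<delta> ^ j + (1 + R / \<delta>) ^ j * norm (\<psi> ?t))"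
      by (simp add: power_divide algebra_simps)
    also have "\<dots> \<le> 2 ^ j * (B / \<delta> ^ j + (1 + R / \<delta>) ^ j * C)"
      using B[of ?t] C[of ?t] assms
      by (intro mult_left_mono add_mono divide_right_mono) (auto simp: power_abs)
    finally show "(1 + \<bar>real_of_int n\<bar>) ^ j * norm (\<psi> ?t) \<le> 2 ^ j * (B / \<delta> ^ j + (1 + R / \<delta>) ^ j * C)" .
  qed
qed

text \<open>More general than the expansion at hand, so that derivatives have the same form:
  differentiation in Re z multiplies \<open>\<alpha> n\<close> by 2\<pi>in, and differentiation in
  Im z differentiates each \<open>\<psi> n\<close>. Later lemmas require \<open>range \<psi>\<close>
  to be finite, which is what remains of periodicity in the index and survives
  differentiation.\<close>

definition qp_term :: "real \<Rightarrow> (int \<Rightarrow> complex) \<Rightarrow> (int \<Rightarrow> real \<Rightarrow> complex) \<Rightarrow> int \<Rightarrow> complex \<Rightarrow> complex" where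
  "qp_term \<delta> \<alpha> \<psi> n z = \<alpha> n * fourier_mode n (Re z) * \<psi> n (Im z + n * \<delta>)"

definition qp_series :: "real \<Rightarrow> (int \<Rightarrow> complex) \<Rightarrow> (int \<Rightarrow> real \<Rightarrow> complex) \<Rightarrow> complex \<Rightarrow> complex" where
  "qp_series \<delta> \<alpha> \<psi> z = (\<Sum>\<^sub>\<infinity>n. qp_term \<delta> \<alpha> \<psi> n z)"

definition poly_growth :: "(int \<Rightarrow> complex) \<Rightarrow> bool" where
  "poly_growth \<alpha> \<longleftrightarrow> (\<exists>C j. \<forall>n. norm (\<alpha> n) \<le> C * (1 + \<bar>real_of_int n\<bar>) ^ j)"

lemma poly_growth_mult_index:
  assumes "poly_growth \<alpha>"
  shows "poly_growth (\<lambda>n. c * of_int n * \<alpha> n)"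
proof -
  obtain C j where C: "\<And>n. norm (\<alpha> n) \<le> C * (1 + \<bar>real_of_int n\<bar>) ^ j"
    using assms by (auto simp: poly_growth_def)
  have "norm (c * of_int n * \<alpha> n) \<le> (norm c * C) * (1 + \<bar>real_of_int n\<bar>) ^ Suc j" for n
  proof -
    have "norm (c * of_int n * \<alpha> n) \<le> (norm c * (1 + \<bar>real_of_int n\<bar>)) * (C * (1 + \<bar>real_of_int n\<bar>) ^ j)"
      unfolding norm_mult by (intro mult_mono C mult_left_mono) auto
    then show ?thesis by (simp add: mult_ac)
  qed
  then show ?thesis unfolding poly_growth_def by blast
qed

text \<open>Decay of order \<open>j + 2\<close> is drawn from the Schwartz functions:
  \<open>j\<close> powers absorb the growth of \<open>\<alpha>\<close>, and two are left for a
  summable majorant.\<close>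

lemma qp_term_bound:
  assumes "0 < \<delta>" "0 \<le> R" "poly_growth \<alpha>" "finite (range \<psi>)" "range \<psi> \<subseteq> schwartz"
  obtains M where "\<And>n z. \<bar>Im z\<bar> \<le> R \<Longrightarrow> norm (qp_term \<delta> \<alpha> \<psi> n z) \<le> M * (1 / (1 + \<bar>real_of_int n\<bar>)\<^sup>2)"
proof -
  obtain C j where C: "\<And>n. norm (\<alpha> n) \<le> C * (1 + \<bar>real_of_int n\<bar>) ^ j"
    using assms by (auto simp: poly_growth_def)
  have "C \<ge> 0" using order_trans[OF norm_ge_zero C[of 0]] by simp
  have "\<forall>\<phi>\<in>range \<psi>. \<exists>M. \<forall>(n::int) y. \<bar>y\<bar> \<le> R \<longrightarrow>
      (1 + \<bar>real_of_int n\<bar>) ^ (j + 2) * norm (\<phi> (y + n * \<delta>)) \<le> M"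
    using assms schwartz_decay_on_translates[of _ \<delta> R "j + 2"] by (metis subsetD)
  then obtain M where M: "\<And>m (n::int) y. \<bar>y\<bar> \<le> R \<Longrightarrow>
      (1 + \<bar>real_of_int n\<bar>) ^ (j + 2) * norm (\<psi> m (y + n * \<delta>)) \<le> M (\<psi> m)"
    by (metis rangeI)
  \<comment> \<open>One constant for all indices, available because only finitely many different
    functions occur.\<close>
  define K where "K = Max (M ` range \<psi>)"
  have K: "M (\<psi> m) \<le> K" for m
    unfolding K_def using assms by (intro Max_ge) auto
  show ?thesis
  proof (rule that)
    fix n :: int and z assume z: "\<bar>Im z\<bar> \<le> R"
    let ?N = "1 + \<bar>real_of_int n\<bar>"
    have "norm (qp_term \<delta> \<alpha> \<psi> n z) * ?N\<^sup>2 = norm (\<alpha> n) * (norm (\<psi> n (Im z + n * \<delta>)) * ?N\<^sup>2)"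
      by (simp add: qp_term_def norm_mult)
    also have "\<dots> \<le> (C * ?N ^ j) * (norm (\<psi> n (Im z + n * \<delta>)) * ?N\<^sup>2)"
      by (intro mult_right_mono C) auto
    also have "\<dots> = C * (?N ^ (j + 2) * norm (\<psi> n (Im z + n * \<delta>)))"
      by (simp only: power_add mult_ac)
    also have "\<dots> \<le> C * K"
      using M[OF z, of n n] K[of n] \<open>C \<ge> 0\<close> by (intro mult_left_mono) auto
    finally show "norm (qp_term \<delta> \<alpha> \<psi> n z) \<le> (C * K) * (1 / ?N\<^sup>2)"
      by (simp add: field_simps)
  qed
qed

lemma qp_series_has_sum:
  assumes "0 < \<delta>" "poly_growth \<alpha>" "finite (range \<psi>)" "range \<psi> \<subseteq> schwartz"
  shows "((\<lambda>n. qp_term \<delta> \<alpha> \<psi> n z) has_sum qp_series \<delta> \<alpha> \<psi> z) UNIV"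
proof -
  obtain M where M: "\<And>n. norm (qp_term \<delta> \<alpha> \<psi> n z) \<le> M * (1 / (1 + \<bar>real_of_int n\<bar>)\<^sup>2)"
    using qp_term_bound[of \<delta> "\<bar>Im z\<bar>" \<alpha> \<psi>] assms by (metis abs_ge_zero order_refl)
  have "(\<lambda>n. norm (qp_term \<delta> \<alpha> \<psi> n z)) summable_on UNIV"
    by (rule summable_on_comparison_test[OF summable_on_cmult_right[OF summable_on_int_inverse_squares, of M]])
       (use M in auto)
  then have "(\<lambda>n. qp_term \<delta> \<alpha> \<psi> n z) summable_on UNIV"
    by (simp add: summable_on_iff_abs_summable_on_complex)
  then show ?thesis unfolding qp_series_def by (rule has_sum_infsum)
qed

text \<open>The sum over the integers is enumerated by \<open>int_decode\<close>, since termwise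
  differentiation is applied to series indexed by naturals.\<close>

lemma qp_series_sums:
  assumes "0 < \<delta>" "poly_growth \<alpha>" "finite (range \<psi>)" "range \<psi> \<subseteq> schwartz"
  shows "(\<lambda>i. qp_term \<delta> \<alpha> \<psi> (int_decode i) z) sums qp_series \<delta> \<alpha> \<psi> z"
  using qp_series_has_sum[OF assms, of z]
    has_sum_reindex_bij_betw[OF bij_int_decode, of "\<lambda>n. qp_term \<delta> \<alpha> \<psi> n z"]
  by (simp add: has_sum_imp_sums)

lemma qp_series_uniform_limit:
  assumes "0 < \<delta>" "0 \<le> R" "poly_growth \<alpha>" "finite (range \<psi>)" "range \<psi> \<subseteq> schwartz"
  shows "uniform_limit {z. \<bar>Im z\<bar> < R} (\<lambda>k z. \<Sum>i<k. qp_term \<delta> \<alpha> \<psi> (int_decode i) z)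
    (qp_series \<delta> \<alpha> \<psi>) sequentially"
proof -
  obtain M where M: "\<And>n z. \<bar>Im z\<bar> \<le> R \<Longrightarrow> norm (qp_term \<delta> \<alpha> \<psi> n z) \<le> M * (1 / (1 + \<bar>real_of_int n\<bar>)\<^sup>2)"
    using qp_term_bound assms by metis
  have "(\<lambda>n::int. M * (1 / (1 + \<bar>real_of_int n\<bar>)\<^sup>2)) summable_on UNIV"
    by (intro summable_on_cmult_right summable_on_int_inverse_squares)
  then have "(\<lambda>i. M * (1 / (1 + \<bar>real_of_int (int_decode i)\<bar>)\<^sup>2)) summable_on UNIV"
    using summable_on_reindex_bij_betw[OF bij_int_decode] by fastforce
  then have "summable (\<lambda>i. M * (1 / (1 + \<bar>real_of_int (int_decode i)\<bar>)\<^sup>2))"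
    by (rule summable_on_imp_summable)
  then have "uniform_limit {z. \<bar>Im z\<bar> < R} (\<lambda>k z. \<Sum>i<k. qp_term \<delta> \<alpha> \<psi> (int_decode i) z)
      (\<lambda>z. \<Sum>i. qp_term \<delta> \<alpha> \<psi> (int_decode i) z) sequentially"
    by (rule Weierstrass_m_test[rotated]) (use M in auto)
  moreover have "(\<Sum>i. qp_term \<delta> \<alpha> \<psi> (int_decode i) z) = qp_series \<delta> \<alpha> \<psi> z" for z
    using qp_series_sums[OF assms(1,3-5)] by (simp add: sums_iff)
  ultimately show ?thesis by simp
qed

section \<open>Termwise differentiation and smoothness of the series\<close>

lemma qp_term_has_derivative:
  assumes "range \<psi> \<subseteq> schwartz"
  shows "(qp_term \<delta> \<alpha> \<psi> n has_derivative (\<lambda>v.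
      Re v *\<^sub>R qp_term \<delta> (\<lambda>n. 2 * pi * \<i> * of_int n * \<alpha> n) \<psi> n z +
      Im v *\<^sub>R qp_term \<delta> \<alpha> (\<lambda>n t. vector_derivative (\<psi> n) (at t)) n z)) (at z)"
proof -
  have 1: "((\<lambda>z. fourier_mode n (Re z)) has_derivative
      (\<lambda>v. Re v *\<^sub>R (2 * pi * \<i> * of_int n * fourier_mode n (Re z)))) (at z)"
    using has_derivative_compose[OF has_derivative_Re[OF has_derivative_ident]
        fourier_mode_has_vector_derivative[unfolded has_vector_derivative_def]] by simp
  have "((\<lambda>z. Im z + n * \<delta>) has_derivative Im) (at z)"
    by (auto intro!: derivative_eq_intros)
  moreover have "\<psi> n \<in> schwartz" using assms by auto
  ultimately have 2: "((\<lambda>z. \<psi> n (Im z + n * \<delta>)) has_derivative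
      (\<lambda>v. Im v *\<^sub>R vector_derivative (\<psi> n) (at (Im z + n * \<delta>)))) (at z)"
    using has_derivative_compose[OF _ schwartz_has_vector_derivative[unfolded has_vector_derivative_def]] by blast
  have "qp_term \<delta> \<alpha> \<psi> n = (\<lambda>z. \<alpha> n * (fourier_mode n (Re z) * \<psi> n (Im z + n * \<delta>)))"
    by (simp add: qp_term_def fun_eq_iff)
  then show ?thesis
    using has_derivative_mult_right[OF has_derivative_mult[OF 1 2], of "\<alpha> n"]
    by (simp add: qp_term_def distrib_left mult_ac add.commute)
qed

lemma qp_series_has_derivative:
  assumes "0 < \<delta>" "poly_growth \<alpha>" "finite (range \<psi>)" "range \<psi> \<subseteq> schwartz"
  shows "(qp_series \<delta> \<alpha> \<psi> has_derivative (\<lambda>v.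
      Re v *\<^sub>R qp_series \<delta> (\<lambda>n. 2 * pi * \<i> * of_int n * \<alpha> n) \<psi> z +
      Im v *\<^sub>R qp_series \<delta> \<alpha> (\<lambda>n t. vector_derivative (\<psi> n) (at t)) z)) (at z)"
proof -
  let ?\<alpha>' = "\<lambda>n. 2 * pi * \<i> * of_int n * \<alpha> n" and ?\<psi>' = "\<lambda>n t. vector_derivative (\<psi> n) (at t)"
  \<comment> \<open>A horizontal strip around \<open>z\<close>: bounded in Im, as the uniform bounds
    require, convex, as termwise differentiation requires, and open, so that the derivative within
    it is the derivative at \<open>z\<close>.\<close>
  define S where "S = {w. \<bar>Im w\<bar> < \<bar>Im z\<bar> + 1}"
  let ?f' = "\<lambda>i w v. Re v *\<^sub>R qp_term \<delta> ?\<alpha>' \<psi> (int_decode i) w + Im v *\<^sub>R qp_term \<delta> \<alpha> ?\<psi>' (int_decode i) w"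
  let ?g' = "\<lambda>w v. Re v *\<^sub>R qp_series \<delta> ?\<alpha>' \<psi> w + Im v *\<^sub>R qp_series \<delta> \<alpha> ?\<psi>' w"
  have \<alpha>': "poly_growth ?\<alpha>'" using assms(2) by (rule poly_growth_mult_index)
  have "range ?\<psi>' = (\<lambda>\<phi> t. vector_derivative \<phi> (at t)) ` range \<psi>" by auto
  then have \<psi>': "finite (range ?\<psi>')" "range ?\<psi>' \<subseteq> schwartz"
    using assms schwartz_vector_derivative by auto
  have S_eq: "S = {w. Im w < \<bar>Im z\<bar> + 1} \<inter> {w. - (\<bar>Im z\<bar> + 1) < Im w}" by (auto simp: S_def)
  have "open S" unfolding S_eq by (intro open_Int open_halfspace_Im_lt open_halfspace_Im_gt)
  have "convex S" unfolding S_eq by (intro convex_Int convex_halfspace_Im_lt convex_halfspace_Im_gt)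
  have "z \<in> S" by (simp add: S_def)
  have "\<exists>g. \<forall>w\<in>S. (\<lambda>i. qp_term \<delta> \<alpha> \<psi> (int_decode i) w) sums g w \<and> (g has_derivative ?g' w) (at w within S)"
  proof (rule has_derivative_series[OF \<open>convex S\<close> _ _ \<open>z \<in> S\<close> qp_series_sums[OF assms]])
    show "(qp_term \<delta> \<alpha> \<psi> (int_decode i) has_derivative ?f' i w) (at w within S)" for i w
      by (rule has_derivative_at_withinI[OF qp_term_has_derivative[OF assms(4)]])
    fix e :: real assume "e > 0"
    have "\<forall>\<^sub>F k in sequentially. \<forall>w\<in>S. dist (\<Sum>i<k. qp_term \<delta> ?\<alpha>' \<psi> (int_decode i) w) (qp_series \<delta> ?\<alpha>' \<psi> w) < e / 2"
      unfolding S_def using \<open>e > 0\<close>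
      by (intro uniform_limitD[OF qp_series_uniform_limit] assms \<alpha>') auto
    moreover have "\<forall>\<^sub>F k in sequentially. \<forall>w\<in>S. dist (\<Sum>i<k. qp_term \<delta> \<alpha> ?\<psi>' (int_decode i) w) (qp_series \<delta> \<alpha> ?\<psi>' w) < e / 2"
      unfolding S_def using \<open>e > 0\<close>
      by (intro uniform_limitD[OF qp_series_uniform_limit] assms \<psi>') auto
    ultimately show "\<forall>\<^sub>F k in sequentially. \<forall>w\<in>S. \<forall>v. norm ((\<Sum>i<k. ?f' i w v) - ?g' w v) \<le> e * norm v"
    proof eventually_elim
      case (elim k)
      show ?case
      proof (intro ballI allI)
        fix w v assume "w \<in> S"
        let ?a = "(\<Sum>i<k. qp_term \<delta> ?\<alpha>' \<psi> (int_decode i) w) - qp_series \<delta> ?\<alpha>' \<psi> w"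
        let ?b = "(\<Sum>i<k. qp_term \<delta> \<alpha> ?\<psi>' (int_decode i) w) - qp_series \<delta> \<alpha> ?\<psi>' w"
        have eq: "(\<Sum>i<k. ?f' i w v) - ?g' w v = Re v *\<^sub>R ?a + Im v *\<^sub>R ?b"
          by (simp add: sum.distrib scaleR_sum_right[symmetric] scaleR_diff_right)
        have "norm ((\<Sum>i<k. ?f' i w v) - ?g' w v) \<le> norm (Re v *\<^sub>R ?a) + norm (Im v *\<^sub>R ?b)"
          unfolding eq by (rule norm_triangle_ineq)
        also have "\<dots> = \<bar>Re v\<bar> * norm ?a + \<bar>Im v\<bar> * norm ?b" by simp
        also have "\<dots> \<le> norm v * (e / 2) + norm v * (e / 2)"
          using elim \<open>w \<in> S\<close> less_imp_le
          by (intro add_mono mult_mono abs_Re_le_cmod abs_Im_le_cmod) (auto simp: dist_norm)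
        finally show "norm ((\<Sum>i<k. ?f' i w v) - ?g' w v) \<le> e * norm v" by (simp add: mult.commute)
      qed
    qed
  qed
  then obtain g where g: "\<And>w. w \<in> S \<Longrightarrow> (\<lambda>i. qp_term \<delta> \<alpha> \<psi> (int_decode i) w) sums g w"
    "\<And>w. w \<in> S \<Longrightarrow> (g has_derivative ?g' w) (at w within S)" by blast
  \<comment> \<open>Termwise differentiation only yields some limit function \<open>g\<close>;
    uniqueness of sums identifies it with the series on the strip.\<close>
  have eq: "g w = qp_series \<delta> \<alpha> \<psi> w" if "w \<in> S" for w
    using sums_unique2[OF g(1)[OF that] qp_series_sums[OF assms]] .
  have "(g has_derivative ?g' z) (at z)"
    using g(2)[OF \<open>z \<in> S\<close>] unfolding at_within_open[OF \<open>z \<in> S\<close> \<open>open S\<close>] .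
  then show ?thesis
    by (rule has_derivative_transform_within_open[OF _ \<open>open S\<close> \<open>z \<in> S\<close> eq])
qed

text \<open>For fixed \<open>\<delta>\<close> the class of all such series is closed under partial
  derivatives: evaluating the derivative at 1 and at \<i> picks out the series with new coefficients
  and the series with differentiated functions.\<close>

lemma smooth_qp_series:
  assumes "0 < \<delta>" "poly_growth \<alpha>" "finite (range \<psi>)" "range \<psi> \<subseteq> schwartz"
  shows "smooth (qp_series \<delta> \<alpha> \<psi>)"
proof -
  define X where "X = {qp_series \<delta> \<alpha> \<psi> | \<alpha> \<psi>. poly_growth \<alpha> \<and> finite (range \<psi>) \<and> range \<psi> \<subseteq> schwartz}"
  have XI: "qp_series \<delta> \<alpha> \<psi> \<in> X" if "poly_growth \<alpha>" "finite (range \<psi>)" "range \<psi> \<subseteq> schwartz" for \<alpha> \<psi>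
    using that by (auto simp: X_def)
  show ?thesis
  proof (rule smooth_coinduct)
    show "qp_series \<delta> \<alpha> \<psi> \<in> X" using assms by (intro XI)
    fix g assume "g \<in> X"
    then obtain \<alpha> \<psi> where g: "g = qp_series \<delta> \<alpha> \<psi>"
      and *: "poly_growth \<alpha>" "finite (range \<psi>)" "range \<psi> \<subseteq> schwartz" by (auto simp: X_def)
    let ?\<alpha>' = "\<lambda>n. 2 * pi * \<i> * of_int n * \<alpha> n" and ?\<psi>' = "\<lambda>n t. vector_derivative (\<psi> n) (at t)"
    have \<alpha>': "poly_growth ?\<alpha>'" using *(1) by (rule poly_growth_mult_index)
    have "range ?\<psi>' = (\<lambda>\<phi> t. vector_derivative \<phi> (at t)) ` range \<psi>" by auto
    then have \<psi>': "finite (range ?\<psi>')" "range ?\<psi>' \<subseteq> schwartz"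
      using * schwartz_vector_derivative by auto
    let ?D = "\<lambda>z v. Re v *\<^sub>R qp_series \<delta> ?\<alpha>' \<psi> z + Im v *\<^sub>R qp_series \<delta> \<alpha> ?\<psi>' z"
    show "\<exists>D. (\<forall>x. (g has_derivative D x) (at x)) \<and> (\<forall>b\<in>Basis. (\<lambda>x. D x b) \<in> X)"
    proof (intro exI[of _ ?D] conjI allI ballI)
      show "(g has_derivative ?D z) (at z)" for z
        unfolding g by (rule qp_series_has_derivative[OF assms(1) *])
      show "(\<lambda>x. ?D x b) \<in> X" if "b \<in> Basis" for b
        using that XI[OF \<alpha>' *(2,3)] XI[OF *(1) \<psi>'] by (auto simp: Basis_complex_def)
    qed
  qed
qed

section \<open>The decomposition of quasi-periodic functions\<close>

definition row_coeff :: "(complex \<Rightarrow> complex) \<Rightarrow> int \<Rightarrow> real \<Rightarrow> complex" where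
  "row_coeff f n y = fourier_coeff (\<lambda>x. f (Complex x y)) n"

lemma has_vector_derivative_along_line:
  assumes "f differentiable at (a + t *\<^sub>R v)"
  shows "((\<lambda>t. f (a + t *\<^sub>R v)) has_vector_derivative frechet_derivative f (at (a + t *\<^sub>R v)) v) (at t)"
proof -
  have "((\<lambda>t. a + t *\<^sub>R v) has_vector_derivative v) (at t)"
    by (auto intro!: derivative_eq_intros)
  moreover have "(f has_derivative frechet_derivative f (at (a + t *\<^sub>R v))) (at (a + t *\<^sub>R v))"
    using assms by (simp add: frechet_derivative_works)
  ultimately show ?thesis
    using vector_derivative_diff_chain_within[of "\<lambda>t. a + t *\<^sub>R v" v t UNIV f]
    by (simp add: o_def has_derivative_at_withinI)
qed

lemma smooth_partial_Re:
  assumes "smooth f"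
  shows "((\<lambda>x. f (Complex x y)) has_vector_derivative frechet_derivative f (at (Complex x y)) 1) (at x)"
proof -
  have eq: "Complex 0 y + x *\<^sub>R 1 = Complex x y" for x by (simp add: complex_eq_iff)
  from has_vector_derivative_along_line[OF smooth_differentiable[OF assms], of "Complex 0 y" 1 x]
  show ?thesis unfolding eq .
qed

lemma smooth_partial_Im:
  assumes "smooth f"
  shows "((\<lambda>y. f (Complex x y)) has_vector_derivative frechet_derivative f (at (Complex x y)) \<i>) (at y)"
proof -
  have eq: "Complex x 0 + y *\<^sub>R \<i> = Complex x y" for y by (simp add: complex_eq_iff)
  from has_vector_derivative_along_line[OF smooth_differentiable[OF assms], of "Complex x 0" \<i> y]
  show ?thesis unfolding eq .
qed

lemma smooth_continuous_on_Complex: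
  assumes "smooth f" "continuous_on S g" "continuous_on S h"
  shows "continuous_on S (\<lambda>x. f (Complex (g x) (h x)))"
proof -
  have "continuous_on S (\<lambda>x. Complex (g x) (h x))"
    unfolding Complex_eq by (intro continuous_intros assms)
  then show ?thesis
    using continuous_on_compose2[OF smooth_continuous_on[OF assms(1), of UNIV]] by simp
qed

lemma frechet_derivative_translate:
  assumes "f differentiable at (z + a)"
  shows "frechet_derivative (\<lambda>z. f (z + a)) (at z) = frechet_derivative f (at (z + a))"
proof -
  have "((\<lambda>z. z + a) has_derivative (\<lambda>v. v)) (at z)"
    by (auto intro!: derivative_eq_intros)
  moreover have "(f has_derivative frechet_derivative f (at (z + a))) (at (z + a))"
    using assms by (simp add: frechet_derivative_works)
  ultimately have "((\<lambda>z. f (z + a)) has_derivative frechet_derivative f (at (z + a))) (at z)"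
    using has_derivative_compose by blast
  then show ?thesis using frechet_derivative_at by metis
qed

lemma periodic_frechet_derivative:
  assumes "smooth f" "\<And>z. f (z + 1) = f z"
  shows "frechet_derivative f (at (z + 1)) = frechet_derivative f (at z)"
  using frechet_derivative_translate[of f z 1] smooth_differentiable[OF assms(1)] assms(2) by simp

lemma row_coeff_has_vector_derivative:
  assumes "smooth f"
  shows "(row_coeff f n has_vector_derivative row_coeff (\<lambda>z. frechet_derivative f (at z) \<i>) n y) (at y)"
proof -
  have "((\<lambda>y. integral (cbox 0 1) (\<lambda>x. fourier_mode (- n) x * f (Complex x y))) has_vector_derivative
      integral (cbox 0 1) (\<lambda>x. fourier_mode (- n) x * frechet_derivative f (at (Complex x y)) \<i>)) (at y within UNIV)"
  proof (rule leibniz_rule_vector_derivative)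
    show "((\<lambda>y. fourier_mode (- n) x * f (Complex x y)) has_vector_derivative
        fourier_mode (- n) x * frechet_derivative f (at (Complex x y)) \<i>) (at y within UNIV)" for x y
      by (rule has_vector_derivative_mult_right[OF smooth_partial_Im[OF assms]])
    show "(\<lambda>x. fourier_mode (- n) x * f (Complex x y)) integrable_on cbox 0 1" for y
      by (intro integrable_continuous continuous_intros smooth_continuous_on_Complex assms)
    show "continuous_on (UNIV \<times> cbox 0 1)
        (\<lambda>(y, x). fourier_mode (- n) x * frechet_derivative f (at (Complex x y)) \<i>)"
      unfolding case_prod_unfold
      by (intro continuous_intros
          smooth_continuous_on_Complex[OF smooth_frechet_derivative[OF assms]])
  qed auto
  then show ?thesis unfolding row_coeff_def[abs_def] fourier_coeff_def by simp
qed

text \<open>Integration by parts over one period; the boundary terms cancel by periodicity.\<close>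

lemma row_coeff_mult_index:
  assumes "smooth f" "\<And>z. f (z + 1) = f z"
  shows "2 * pi * \<i> * of_int n * row_coeff f n y = row_coeff (\<lambda>z. frechet_derivative f (at z) 1) n y"
proof -
  let ?f' = "\<lambda>x. frechet_derivative f (at (Complex x y)) 1"
  have "f (Complex 1 y) = f (Complex 0 y)"
    using assms(2)[of "Complex 0 y"] by (simp add: Complex_eq add.commute)
  moreover have "((\<lambda>x. fourier_mode (- n) x * ?f' x + 2 * pi * \<i> * of_int (- n) * fourier_mode (- n) x * f (Complex x y))
      has_integral (fourier_mode (- n) 1 * f (Complex 1 y) - fourier_mode (- n) 0 * f (Complex 0 y))) {0..1}"
  proof (rule fundamental_theorem_of_calculus)
    show "((\<lambda>x. fourier_mode (- n) x * f (Complex x y)) has_vector_derivative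
        fourier_mode (- n) x * ?f' x + 2 * pi * \<i> * of_int (- n) * fourier_mode (- n) x * f (Complex x y))
        (at x within {0..1})" for x
      by (rule has_vector_derivative_at_within[OF
            has_vector_derivative_mult[OF fourier_mode_has_vector_derivative smooth_partial_Re[OF assms(1)]]])
  qed simp
  ultimately have "((\<lambda>x. fourier_mode (- n) x * ?f' x + (- (2 * pi * \<i> * of_int n)) * (fourier_mode (- n) x * f (Complex x y)))
      has_integral 0) {0..1}"
    by (simp add: mult.assoc)
  moreover have "((\<lambda>x. fourier_mode (- n) x * ?f' x + (- (2 * pi * \<i> * of_int n)) * (fourier_mode (- n) x * f (Complex x y)))
      has_integral (fourier_coeff ?f' n + (- (2 * pi * \<i> * of_int n)) * fourier_coeff (\<lambda>x. f (Complex x y)) n)) {0..1}"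
    by (intro has_integral_add has_integral_mult_right has_integral_fourier_coeff
        smooth_continuous_on_Complex smooth_frechet_derivative[OF assms(1)] assms continuous_intros)
  ultimately have "0 = fourier_coeff ?f' n + (- (2 * pi * \<i> * of_int n)) * fourier_coeff (\<lambda>x. f (Complex x y)) n"
    by (rule has_integral_unique)
  then show ?thesis by (simp add: row_coeff_def)
qed

text \<open>Each power of |n| is paid for by one derivative in Re z, which is again smooth and
  periodic; hence the induction over all \<open>f\<close>. Order 0 is boundedness on the compact
  rectangle of one period and height at most \<open>R\<close>.\<close>

lemma row_coeff_decay:
  assumes "smooth f" "\<And>z. f (z + 1) = f z"
  obtains M where "\<And>n y. \<bar>y\<bar> \<le> R \<Longrightarrow> (1 + \<bar>real_of_int n\<bar>) ^ j * norm (row_coeff f n y) \<le> M"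
proof -
  have "\<exists>M. \<forall>n y. \<bar>y\<bar> \<le> R \<longrightarrow> (1 + \<bar>real_of_int n\<bar>) ^ j * norm (row_coeff f n y) \<le> M"
    using assms
  proof (induction j arbitrary: f)
    case 0
    have "compact ({0..1::real} \<times> {-R..R})" by (intro compact_Times) auto
    moreover have "continuous_on ({0..1} \<times> {-R..R}) (\<lambda>p. f (Complex (fst p) (snd p)))"
      by (intro smooth_continuous_on_Complex 0 continuous_intros)
    ultimately have "bounded ((\<lambda>p. f (Complex (fst p) (snd p))) ` ({0..1} \<times> {-R..R}))"
      by (intro compact_imp_bounded compact_continuous_image)
    then obtain B where B: "\<And>x y. x \<in> {0..1} \<Longrightarrow> y \<in> {-R..R} \<Longrightarrow> norm (f (Complex x y)) \<le> B"
      unfolding bounded_iff by fastforce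
    have "norm (row_coeff f n y) \<le> B" if "\<bar>y\<bar> \<le> R" for n y
      unfolding row_coeff_def using that
      by (intro norm_fourier_coeff_le smooth_continuous_on_Complex 0 continuous_intros B) auto
    then show ?case by auto
  next
    case (Suc j)
    obtain M where M: "\<And>n y. \<bar>y\<bar> \<le> R \<Longrightarrow> (1 + \<bar>real_of_int n\<bar>) ^ j * norm (row_coeff f n y) \<le> M"
      using Suc.IH[OF Suc.prems] by blast
    let ?f' = "\<lambda>z. frechet_derivative f (at z) 1"
    obtain M' where M': "\<And>n y. \<bar>y\<bar> \<le> R \<Longrightarrow> (1 + \<bar>real_of_int n\<bar>) ^ j * norm (row_coeff ?f' n y) \<le> M'"
      using Suc.IH[of ?f'] smooth_frechet_derivative[OF Suc.prems(1)] periodic_frechet_derivative[OF Suc.prems]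
      by auto
    have "(1 + \<bar>real_of_int n\<bar>) ^ Suc j * norm (row_coeff f n y) \<le> M + M'" if y: "\<bar>y\<bar> \<le> R" for n y
    proof -
      have "1 \<le> 2 * pi" using pi_ge_two by simp
      then have "\<bar>real_of_int n\<bar> * norm (row_coeff f n y) \<le> 2 * pi * (\<bar>real_of_int n\<bar> * norm (row_coeff f n y))"
        using mult_right_mono[of 1 "2 * pi" "\<bar>real_of_int n\<bar> * norm (row_coeff f n y)"] by simp
      also have "\<dots> = norm (row_coeff ?f' n y)"
        unfolding row_coeff_mult_index[OF Suc.prems, symmetric] by (simp add: norm_mult)
      finally have "(1 + \<bar>real_of_int n\<bar>) ^ j * (norm (row_coeff f n y) + \<bar>real_of_int n\<bar> * norm (row_coeff f n y))
          \<le> (1 + \<bar>real_of_int n\<bar>) ^ j * (norm (row_coeff f n y) + norm (row_coeff ?f' n y))"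
        by (intro mult_left_mono) auto
      also have "\<dots> \<le> M + M'" using M[OF y, of n] M'[OF y, of n] by (simp add: distrib_left)
      finally show ?thesis by (simp add: algebra_simps)
    qed
    then show ?case by blast
  qed
  then show ?thesis using that by blast
qed

lemma row_coeff_has_sum:
  assumes "smooth f" "\<And>z. f (z + 1) = f z"
  shows "((\<lambda>n. row_coeff f n (Im z) * fourier_mode n (Re z)) has_sum f z) UNIV"
proof -
  let ?g = "\<lambda>x. f (Complex x (Im z))"
  \<comment> \<open>Order 2 suffices for absolute summability.\<close>
  obtain M where M: "\<And>n y. \<bar>y\<bar> \<le> \<bar>Im z\<bar> \<Longrightarrow> (1 + \<bar>real_of_int n\<bar>) ^ 2 * norm (row_coeff f n y) \<le> M"
    using row_coeff_decay[OF assms, of "\<bar>Im z\<bar>" 2] by blast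
  have "(\<lambda>n. norm (fourier_coeff ?g n)) summable_on UNIV"
  proof (rule summable_on_comparison_test[OF summable_on_cmult_right[OF summable_on_int_inverse_squares, of M]])
    show "norm (fourier_coeff ?g n) \<le> M * (1 / (1 + \<bar>real_of_int n\<bar>)\<^sup>2)" for n
      using M[of "Im z" n] by (simp add: row_coeff_def pos_le_divide_eq mult.commute)
  qed auto
  moreover have "?g (x + 1) = ?g x" for x
    using assms(2)[of "Complex x (Im z)"] by (simp add: Complex_eq algebra_simps)
  ultimately have "((\<lambda>n. fourier_coeff ?g n * fourier_mode n (Re z)) has_sum ?g (Re z)) UNIV"
    by (intro fourier_inversion[OF smooth_partial_Re[OF assms(1)]]
        smooth_continuous_on_Complex smooth_frechet_derivative assms(1) continuous_intros) auto
  then show ?thesis by (simp add: row_coeff_def)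
qed

text \<open>The multiplier for translation by \<open>\<tau>\<close> depends on Re z alone, so it is
  constant along vertical lines and passes through the derivative in direction \<i>. This closure
  turns the derivative of a component into a component of another module element.\<close>

lemma F_module_frechet_derivative_ii:
  assumes "f \<in> F_module \<tau> p"
  shows "(\<lambda>z. frechet_derivative f (at z) \<i>) \<in> F_module \<tau> p"
proof -
  have f: "smooth f" "\<And>z. f (z + 1) = f z"
    "\<And>z. f (z + \<tau>) = exp (- pi * \<i> * p * (Re \<tau> + 2 * Re z)) * f z"
    using assms by (auto simp: F_module_def)
  have "frechet_derivative f (at (z + \<tau>)) \<i> =
      exp (- pi * \<i> * p * (Re \<tau> + 2 * Re z)) * frechet_derivative f (at z) \<i>" for z
  proof -
    have line: "((\<lambda>t. f (w + t *\<^sub>R \<i>)) has_vector_derivative frechet_derivative f (at w) \<i>) (at 0)" for w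
      using has_vector_derivative_along_line[of f w 0 \<i>] smooth_differentiable[OF f(1)] by simp
    have "f (z + \<tau> + t *\<^sub>R \<i>) = exp (- pi * \<i> * p * (Re \<tau> + 2 * Re z)) * f (z + t *\<^sub>R \<i>)" for t
      using f(3)[of "z + t *\<^sub>R \<i>"] by (simp add: add_ac)
    then have "((\<lambda>t. exp (- pi * \<i> * p * (Re \<tau> + 2 * Re z)) * f (z + t *\<^sub>R \<i>)) has_vector_derivative
        frechet_derivative f (at (z + \<tau>)) \<i>) (at 0)"
      using line[of "z + \<tau>"] by simp
    from vector_derivative_unique_at[OF this has_vector_derivative_mult_right[OF line[of z]]]
    show ?thesis .
  qed
  then show ?thesis
    using smooth_frechet_derivative[OF f(1)] periodic_frechet_derivative[OF f(1,2)]
    by (simp add: F_module_def)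
qed

section \<open>The component functions of a quasi-periodic function\<close>

definition gauss_phase :: "complex \<Rightarrow> nat \<Rightarrow> int \<Rightarrow> complex" where
  "gauss_phase \<tau> p n = exp (pi * \<i> * n\<^sup>2 * (Re \<tau> / p))"

lemma norm_gauss_phase [simp]: "norm (gauss_phase \<tau> p n) = 1"
  by (simp add: gauss_phase_def norm_exp_eq_Re)

lemma gauss_phase_nonzero [simp]: "gauss_phase \<tau> p n \<noteq> 0"
  by (simp add: gauss_phase_def)

text \<open>Because \<^term>\<open>Re \<tau>\<close> is an integer, the periodicity in \<^term>\<open>Re z\<close> absorbs the horizontal part of the
  translation by \<^term>\<open>\<tau>\<close>.\<close>

lemma row_coeff_quasi_periodic:
  assumes "f \<in> F_module \<tau> p" "Re \<tau> = of_int r"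
  shows "row_coeff f n (y + Im \<tau>) = exp (pi * \<i> * p * r) * row_coeff f (n + p) y"
proof -
  have f: "\<And>z. f (z + 1) = f z"
    "\<And>z. f (z + \<tau>) = exp (- pi * \<i> * p * (Re \<tau> + 2 * Re z)) * f z"
    using assms by (auto simp: F_module_def)
  have "fourier_mode (- n) x * f (Complex x (y + Im \<tau>)) =
      exp (pi * \<i> * p * r) * (fourier_mode (- (n + p)) x * f (Complex x y))" for x
  proof -
    have "f (Complex x (y + Im \<tau>)) = f (Complex (x - r) y + \<tau>)"
      using assms(2) by (intro arg_cong[of _ _ f]) (simp add: complex_eq_iff)
    also have "\<dots> = exp (- pi * \<i> * p * (Re \<tau> + 2 * Re (Complex (x - r) y))) * f (Complex (x - r) y)"
      by (rule f(2))
    also have "f (Complex (x - r) y) = f (Complex x y)"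
    proof -
      have "f (Complex (x + 1) y) = f (Complex x y)" for x
        using f(1)[of "Complex x y"] by (simp add: Complex_eq algebra_simps)
      from periodic_of_int[of "\<lambda>x. f (Complex x y)" x "- r", OF this] show ?thesis by simp
    qed
    finally have "fourier_mode (- n) x * f (Complex x (y + Im \<tau>)) =
        (fourier_mode (- n) x * exp (- pi * \<i> * p * (Re \<tau> + 2 * Re (Complex (x - r) y)))) * f (Complex x y)"
      by simp
    \<comment> \<open>Since r + 2(x - r) = 2x - r, the multiplier is e^(-2\<pi>ipx) times a constant
      phase; its mode raises the index from n to n + p.\<close>
    also have "fourier_mode (- n) x * exp (- pi * \<i> * p * (Re \<tau> + 2 * Re (Complex (x - r) y))) =
        exp (pi * \<i> * p * r) * fourier_mode (- (n + p)) x"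
      using assms(2) by (simp add: fourier_mode_def exp_add[symmetric] algebra_simps)
    finally show ?thesis by (simp add: mult.assoc)
  qed
  then show ?thesis by (simp add: row_coeff_def fourier_coeff_def)
qed

text \<open>The expansion solved for its \<open>n\<close>-th function, with t = y + n Im \<tau>/p.
  The index ranges over all integers; dependence on the residue alone is a consequence of
  quasi-periodicity.\<close>

definition component :: "complex \<Rightarrow> nat \<Rightarrow> (complex \<Rightarrow> complex) \<Rightarrow> int \<Rightarrow> real \<Rightarrow> complex" where
  "component \<tau> p f n t = row_coeff f n (t - n * (Im \<tau> / p)) / gauss_phase \<tau> p n"

text \<open>Raising \<open>n\<close> by \<open>p\<close> lowers the height by Im \<tau>.
  Quasi-periodicity converts this into a shift of the coefficient index and a constant phase, which
  matches the quotient of the Gauss phases.\<close>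

lemma component_periodic:
  assumes "f \<in> F_module \<tau> p" "Re \<tau> = of_int r" "1 \<le> p"
  shows "component \<tau> p f (n + k * int p) = component \<tau> p f n"
proof -
  have step: "component \<tau> p f (n + int p) t = component \<tau> p f n t" for n t
  proof -
    have eq: "t - real_of_int (n + int p) * (Im \<tau> / p) + Im \<tau> = t - n * (Im \<tau> / p)"
      using assms(3) by (simp add: field_simps)
    have phase: "exp (pi * \<i> * p * r) / gauss_phase \<tau> p n = 1 / gauss_phase \<tau> p (n + int p)"
    proof -
      \<comment> \<open>From (n + p)^2 r/p = n^2 r/p + 2nr + pr; with the prefactor, pr occurs
        twice, so the surplus is an integer multiple of 2\<pi>i.\<close>
      have "exp (pi * \<i> * p * r) * gauss_phase \<tau> p (n + int p) =
          exp (2 * of_int (n * r + p * r) * pi * \<i>) * gauss_phase \<tau> p n"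
        unfolding gauss_phase_def exp_add[symmetric] using assms(2,3)
        by (intro arg_cong[of _ _ exp]) (simp add: field_simps power2_eq_square)
      also have "exp (2 * of_int (n * r + p * r) * pi * \<i>) = 1"
        by (auto simp: exp_eq_1 intro!: exI[of _ "n * r + p * r"])
      finally show ?thesis by (simp add: field_simps)
    qed
    have "component \<tau> p f n t = exp (pi * \<i> * p * r) / gauss_phase \<tau> p n *
        row_coeff f (n + p) (t - real_of_int (n + int p) * (Im \<tau> / p))"
      using row_coeff_quasi_periodic[OF assms(1,2), of n "t - real_of_int (n + int p) * (Im \<tau> / p)"]
      unfolding eq component_def by simp
    then show ?thesis unfolding phase by (simp add: component_def)
  qed
  show ?thesis
  proof (induction k rule: int_induct[of _ 0])
    case (step1 i)
    then show ?case using step[of "n + i * int p"] by (simp add: fun_eq_iff algebra_simps)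
  next
    case (step2 i)
    then show ?case using step[of "n + (i - 1) * int p"] by (simp add: fun_eq_iff algebra_simps)
  qed simp
qed

lemma component_mod:
  assumes "f \<in> F_module \<tau> p" "Re \<tau> = of_int r" "1 \<le> p"
  shows "component \<tau> p f (n mod int p) = component \<tau> p f n"
  using component_periodic[OF assms, of "n mod int p" "n div int p"] by simp

text \<open>For fixed \<open>n\<close> the components of all module elements form a class closed
  under differentiation. For decay, a large t is reached at bounded height by raising the index in
  steps of \<open>p\<close>, and there the coefficients decay rapidly in the index.\<close>

lemma component_schwartz:
  assumes "f \<in> F_module \<tau> p" "Re \<tau> = of_int r" "1 \<le> p" "0 < Im \<tau>"
  shows "component \<tau> p f n \<in> schwartz"
proof (rule schwartz_coinduct[where X = "(\<lambda>f. component \<tau> p f n) ` F_module \<tau> p"])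
  show "component \<tau> p f n \<in> (\<lambda>f. component \<tau> p f n) ` F_module \<tau> p" using assms by blast
  fix g assume "g \<in> (\<lambda>f. component \<tau> p f n) ` F_module \<tau> p"
  then obtain f where g: "g = component \<tau> p f n" and f: "f \<in> F_module \<tau> p" by blast
  then have smooth: "smooth f" and per: "\<And>z. f (z + 1) = f z" by (auto simp: F_module_def)
  show "\<exists>g'\<in>(\<lambda>f. component \<tau> p f n) ` F_module \<tau> p. \<forall>t. (g has_vector_derivative g' t) (at t)"
  proof (intro bexI allI)
    show "(g has_vector_derivative component \<tau> p (\<lambda>z. frechet_derivative f (at z) \<i>) n t) (at t)" for t
    proof -
      have "((\<lambda>t. t - n * (Im \<tau> / p)) has_vector_derivative 1) (at t)"
        by (auto intro!: derivative_eq_intros)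
      from vector_diff_chain_at[OF this row_coeff_has_vector_derivative[OF smooth]]
      have "((\<lambda>t. row_coeff f n (t - n * (Im \<tau> / p))) has_vector_derivative
          row_coeff (\<lambda>z. frechet_derivative f (at z) \<i>) n (t - n * (Im \<tau> / p))) (at t)"
        by (simp add: o_def)
      from has_vector_derivative_divide[OF this] show ?thesis
        unfolding g component_def[abs_def] .
    qed
  qed (use F_module_frechet_derivative_ii[OF f] in blast)
  fix k
  define \<delta> where "\<delta> = Im \<tau> / p"
  have \<delta>: "0 < \<delta>" "\<delta> * p = Im \<tau>" using assms by (auto simp: \<delta>_def)
  obtain M where M: "\<And>n y. \<bar>y\<bar> \<le> Im \<tau> \<Longrightarrow> (1 + \<bar>real_of_int n\<bar>) ^ k * norm (row_coeff f n y) \<le> M"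
    using row_coeff_decay[OF smooth per, of "Im \<tau>" k] by blast
  have "norm (t ^ k *\<^sub>R g t) \<le> (Im \<tau> + \<delta>) ^ k * M" for t
  proof -
    \<comment> \<open>The number of steps that brings the height t - n\<delta> into the interval
      from 0 to Im \<tau>.\<close>
    define m where "m = \<lfloor>(t - n * \<delta>) / Im \<tau>\<rfloor>"
    define N where "N = n + m * int p"
    define y where "y = t - N * \<delta>"
    have y_eq: "y = t - n * \<delta> - m * Im \<tau>"
      unfolding y_def N_def \<delta>(2)[symmetric] by (simp add: algebra_simps)
    have "m \<le> (t - n * \<delta>) / Im \<tau>" "(t - n * \<delta>) / Im \<tau> < m + 1" unfolding m_def by linarith+
    then have y: "\<bar>y\<bar> \<le> Im \<tau>" unfolding y_eq using assms(4) by (simp add: field_simps abs_if)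
    have "\<bar>t\<bar> \<le> \<bar>y\<bar> + \<bar>real_of_int N\<bar> * \<delta>"
      using abs_triangle_ineq[of y "N * \<delta>"] \<delta>(1) by (simp add: y_def abs_mult)
    also have "\<dots> \<le> Im \<tau> + \<bar>real_of_int N\<bar> * \<delta>" using y by simp
    \<comment> \<open>A crude product form, so that the k-th power splits into a constant and the
      weight controlled by \<open>M\<close>.\<close>
    also have "\<dots> \<le> (Im \<tau> + \<delta>) * (1 + \<bar>real_of_int N\<bar>)"
      using \<delta>(1) assms(4) by (simp add: distrib_left distrib_right mult.commute)
    finally have t: "\<bar>t\<bar> ^ k \<le> (Im \<tau> + \<delta>) ^ k * (1 + \<bar>real_of_int N\<bar>) ^ k"
      unfolding power_mult_distrib[symmetric] by (rule power_mono) simp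
    have "g t = component \<tau> p f N t"
      using component_periodic[OF f assms(2,3)] by (simp add: g N_def)
    then have "norm (g t) = norm (row_coeff f N y)"
      by (simp add: component_def y_def \<delta>_def norm_divide)
    then have "norm (t ^ k *\<^sub>R g t) = \<bar>t\<bar> ^ k * norm (row_coeff f N y)" by (simp add: power_abs)
    also have "\<dots> \<le> (Im \<tau> + \<delta>) ^ k * (1 + \<bar>real_of_int N\<bar>) ^ k * norm (row_coeff f N y)"
      by (rule mult_right_mono[OF t]) simp
    also have "\<dots> = (Im \<tau> + \<delta>) ^ k * ((1 + \<bar>real_of_int N\<bar>) ^ k * norm (row_coeff f N y))"
      by (simp only: mult.assoc)
    also have "\<dots> \<le> (Im \<tau> + \<delta>) ^ k * M"
      using M[OF y, of N] \<delta>(1) assms(4) by (intro mult_left_mono) auto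
    finally show ?thesis .
  qed
  then show "bounded (range (\<lambda>t. t ^ k *\<^sub>R g t))" by (auto simp: bounded_iff)
qed

section \<open>Uniqueness and existence of the expansion\<close>

lemma decomposes_iff:
  "decomposes \<tau> p f h \<longleftrightarrow> (\<forall>z. ((\<lambda>n. gauss_phase \<tau> p n *
     (h $ nat (n mod int p)) (Im z + n * (Im \<tau> / p)) * fourier_mode n (Re z)) has_sum f z) UNIV)"
  unfolding decomposes_def gauss_phase_def fourier_mode_def by (simp only: mult_ac of_int_power)

lemma decomposes_imp_row_coeff:
  assumes "decomposes \<tau> p f h"
  shows "row_coeff f n y = gauss_phase \<tau> p n * (h $ nat (n mod int p)) (y + n * (Im \<tau> / p))"
  unfolding row_coeff_def
  by (rule fourier_coeff_unique)
     (use assms in \<open>auto simp: decomposes_iff dest: spec[of _ "Complex _ y"]\<close>)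

text \<open>At a fixed height the expansion is a Fourier series in Re z, so its coefficients are
  determined. The coefficient of index k at height t - k Im \<tau>/p reads off the k-th entry at t,
  up to a nonzero phase.\<close>

lemma decomposes_unique:
  assumes "decomposes \<tau> p f h" "decomposes \<tau> p f h'" "h \<in> carrier_vec p" "h' \<in> carrier_vec p"
  shows "h = h'"
proof (rule eq_vecI)
  fix k assume "k < dim_vec h'"
  with assms have k: "nat (int k mod int p) = k" by auto
  show "h $ k = h' $ k"
  proof
    fix t
    have "gauss_phase \<tau> p (int k) * (h $ k) t = gauss_phase \<tau> p (int k) * (h' $ k) t"
      using decomposes_imp_row_coeff[OF assms(1), of "int k" "t - k * (Im \<tau> / p)"]
        decomposes_imp_row_coeff[OF assms(2), of "int k" "t - k * (Im \<tau> / p)"] k by simp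
    then show "(h $ k) t = (h' $ k) t" by simp
  qed
qed (use assms in auto)

lemma F_module_decomposes:
  assumes "f \<in> F_module \<tau> p" "Re \<tau> = of_int r" "1 \<le> p" "0 < Im \<tau>"
  shows "\<exists>h\<in>H_module p. decomposes \<tau> p f h"
proof -
  define h where "h = Matrix.vec p (\<lambda>k. component \<tau> p f (int k))"
  have "h \<in> H_module p"
    using component_schwartz[OF assms] by (simp add: h_def H_module_def)
  moreover have "h $ nat (n mod int p) = component \<tau> p f n" for n
    using assms(3) component_mod[OF assms(1-3), of n] by (simp add: h_def nat_less_iff)
  then have "decomposes \<tau> p f h"
    using assms(1) row_coeff_has_sum[of f] by (simp add: decomposes_iff component_def F_module_def)
  ultimately show ?thesis by blast
qed

lemma H_module_synthesis:
  assumes h: "h \<in> H_module p" and "1 \<le> p" "0 < Im \<tau>"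
  shows "\<exists>f\<in>F_module \<tau> p. decomposes \<tau> p f h"
proof -
  define \<delta> where "\<delta> = Im \<tau> / p"
  define \<psi> where "\<psi> n = h $ nat (n mod int p)" for n
  define f where "f = qp_series \<delta> (gauss_phase \<tau> p) \<psi>"
  \<comment> \<open>Only \<open>p\<close> different functions occur, as the general series lemmas
    demand.\<close>
  have "range \<psi> \<subseteq> (\<lambda>k. h $ k) ` {..<p}"
    using assms(2) by (auto simp: \<psi>_def nat_less_iff)
  then have \<psi>: "finite (range \<psi>)" "range \<psi> \<subseteq> schwartz"
    using h finite_subset by (auto simp: H_module_def)
  have \<delta>: "0 < \<delta>" using assms by (simp add: \<delta>_def)
  have \<alpha>: "poly_growth (gauss_phase \<tau> p)"
    unfolding poly_growth_def by (intro exI[of _ 1] exI[of _ 0]) simp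
  have sum: "((\<lambda>n. qp_term \<delta> (gauss_phase \<tau> p) \<psi> n z) has_sum f z) UNIV" for z
    unfolding f_def by (rule qp_series_has_sum[OF \<delta> \<alpha> \<psi>])
  then have dec: "decomposes \<tau> p f h"
    by (simp add: decomposes_iff qp_term_def \<psi>_def \<delta>_def mult_ac)
  have "f (z + 1) = f z" for z
    using sum[of "z + 1"] sum[of z] has_sum_unique
    by (fastforce simp: qp_term_def fourier_mode_add_right)
  moreover have "f (z + \<tau>) = exp (- pi * \<i> * p * (Re \<tau> + 2 * Re z)) * f z" for z
  proof -
    let ?e = "exp (- pi * \<i> * p * (Re \<tau> + 2 * Re z))"
    have "bij (\<lambda>n::int. n + int p)" by (rule o_bij[of "\<lambda>n. n - int p"]) auto
    from has_sum_reindex_bij_betw[OF this, of "\<lambda>n. ?e * qp_term \<delta> (gauss_phase \<tau> p) \<psi> n z" "?e * f z"]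
    have "((\<lambda>n. ?e * qp_term \<delta> (gauss_phase \<tau> p) \<psi> (n + int p) z) has_sum ?e * f z) UNIV"
      using has_sum_cmult_right[OF sum] by simp
    moreover have "?e * qp_term \<delta> (gauss_phase \<tau> p) \<psi> (n + int p) z = qp_term \<delta> (gauss_phase \<tau> p) \<psi> n (z + \<tau>)" for n
    proof -
      \<comment> \<open>Exact equality of exponents: the factor \<open>?e\<close> cancels -p
        \<omega>_x - 2px against the p \<omega>_x + 2px produced by n + p, and the cross term 2n
        \<omega>_x is the shift of Re z by \<omega>_x.\<close>
      have "?e * gauss_phase \<tau> p (n + int p) * fourier_mode (n + int p) (Re z) =
          gauss_phase \<tau> p n * fourier_mode n (Re (z + \<tau>))"
        unfolding gauss_phase_def fourier_mode_def exp_add[symmetric] using assms(2)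
        by (intro arg_cong[of _ _ exp]) (simp add: field_simps power2_eq_square)
      moreover have "\<psi> (n + int p) = \<psi> n" by (simp add: \<psi>_def)
      moreover have "Im z + (n + int p) * \<delta> = Im (z + \<tau>) + n * \<delta>"
        using assms(2) by (simp add: \<delta>_def field_simps)
      ultimately show ?thesis unfolding qp_term_def by (simp only: mult.assoc[symmetric])
    qed
    ultimately show ?thesis using sum[of "z + \<tau>"] has_sum_unique by fastforce
  qed
  ultimately have "f \<in> F_module \<tau> p"
    using smooth_qp_series[OF \<delta> \<alpha> \<psi>] by (simp add: F_module_def f_def)
  with dec show ?thesis by blast
qed

lemma phi_eqI:
  assumes "h \<in> H_module p" "decomposes \<tau> p f h"
  shows "phi \<tau> p f = h"
  unfolding phi_def
proof (rule the_equality)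
  show "h' = h" if "h' \<in> H_module p \<and> decomposes \<tau> p f h'" for h'
    using that assms decomposes_unique by (auto simp: H_module_def)
qed (use assms in blast)

text \<open>Reduces a transported action to a statement about expansions: whichever preimage
  \<open>inv_into\<close> selects, it is decomposed by \<open>h\<close>, and \<open>phi\<close> of
  its image is determined once an expansion of that image in \<open>H_module p\<close> is
  known.\<close>

lemma transported_act_eqI:
  assumes "h \<in> H_module p" "Re \<tau> = of_int r" "1 \<le> p" "0 < Im \<tau>" "h' \<in> H_module p"
    and act: "\<And>f. decomposes \<tau> p f h \<Longrightarrow> decomposes \<tau> p (act \<theta> f a) h'"
  shows "transported_act \<theta> \<tau> p h a = h'"
proof -
  let ?f = "inv_into (F_module \<tau> p) (phi \<tau> p) h"
  have "h \<in> phi \<tau> p ` F_module \<tau> p"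
    using H_module_synthesis[OF assms(1,3,4)] phi_eqI[OF assms(1)] by force
  then have f: "?f \<in> F_module \<tau> p" "phi \<tau> p ?f = h"
    by (rule inv_into_into, rule f_inv_into_f)
  \<comment> \<open>The equation \<open>phi \<tau> p ?f = h\<close> carries information only once
    some expansion of \<open>?f\<close> exists, since \<open>phi\<close> is a definite
    description.\<close>
  obtain h0 where "h0 \<in> H_module p" "decomposes \<tau> p ?f h0"
    using F_module_decomposes[OF f(1) assms(2-4)] by blast
  with f(2) have "decomposes \<tau> p ?f h" using phi_eqI by metis
  then show ?thesis unfolding transported_act_def by (intro phi_eqI assms(5) act)
qed

section \<open>The action of the generators\<close>

text \<open>A closed form for the \<open>k\<close>-th power of the adjoint clock matrix, written
  with Fourier modes so that additivity in \<open>k\<close> is that of the modes.\<close>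

definition phase_mat :: "nat \<Rightarrow> int \<Rightarrow> complex mat" where
  "phase_mat p k = mat p p (\<lambda>(i, j). if i = j then fourier_mode (- k) (i / p) else 0)"

lemma phase_mat_carrier [simp]: "phase_mat p k \<in> carrier_mat p p"
  by (simp add: phase_mat_def)

lemma dim_row_phase_mat [simp]: "dim_row (phase_mat p k) = p"
  by (simp add: phase_mat_def)

lemma phase_mat_mult_index:
  assumes "A \<in> carrier_mat p p" "i < p" "j < p"
  shows "(phase_mat p k * A) $$ (i, j) = fourier_mode (- k) (i / p) * A $$ (i, j)"
proof -
  have "(phase_mat p k * A) $$ (i, j) =
      (\<Sum>l\<in>{0..<p}. (if i = l then fourier_mode (- k) (i / p) else 0) * A $$ (l, j))"
    using assms by (simp add: phase_mat_def scalar_prod_def)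
  then show ?thesis using assms by (simp add: if_distrib[of "\<lambda>x. x * _"] cong: if_cong)
qed

lemma phase_mat_mult: "phase_mat p k * phase_mat p l = phase_mat p (k + l)"
proof (rule eq_matI)
  fix i j assume "i < dim_row (phase_mat p (k + l))" "j < dim_col (phase_mat p (k + l))"
  then have ij: "i < p" "j < p" by (simp_all add: phase_mat_def)
  show "(phase_mat p k * phase_mat p l) $$ (i, j) = phase_mat p (k + l) $$ (i, j)"
    unfolding phase_mat_mult_index[OF phase_mat_carrier ij]
    using fourier_mode_add[of "- k" "- l"] ij by (simp add: phase_mat_def)
qed (simp_all add: phase_mat_def)

lemma phase_mat_0: "phase_mat p 0 = 1\<^sub>m p"
  by (rule eq_matI) (auto simp: phase_mat_def)

lemma adjoint_clock_mat: "mat_adjoint (clock_mat p) = phase_mat p 1"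
proof (rule eq_matI)
  fix i j assume "i < dim_row (phase_mat p 1)" "j < dim_col (phase_mat p 1)"
  then have "i < p" "j < p" by (simp_all add: phase_mat_def)
  then show "mat_adjoint (clock_mat p) $$ (i, j) = phase_mat p 1 $$ (i, j)"
    by (auto simp: mat_adjoint_def mat_of_rows_def clock_mat_def phase_mat_def fourier_mode_def
        exp_cnj conjugate_complex_def)
qed (simp_all add: mat_adjoint_def clock_mat_def phase_mat_def)

text \<open>\<open>phase_mat p\<close> carries addition of integers to matrix multiplication.
  Negative powers are taken through the inverse in the matrix ring, which is therefore
  \<open>phase_mat\<close> at the negated index.\<close>

lemma mat_int_pow_adjoint_clock: "mat_int_pow p (mat_adjoint (clock_mat p)) k = phase_mat p k"
proof -
  let ?G = "ring_mat TYPE(complex) p ()"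
  interpret semiring ?G by (rule semiring_mat)
  have nat_pow: "phase_mat p 1 [^]\<^bsub>?G\<^esub> n = phase_mat p (int n)" for n :: nat
    by (induction n) (simp_all add: ring_mat_simps phase_mat_0 phase_mat_mult add.commute)
  have inv: "inv\<^bsub>?G\<^esub> (phase_mat p l) = phase_mat p (- l)" for l
    by (rule inv_char) (simp_all add: ring_mat_simps phase_mat_mult phase_mat_0)
  show ?thesis
    unfolding mat_int_pow_def adjoint_clock_mat int_pow_def2 by (simp add: nat_pow inv)
qed

text \<open>The expansion runs over all integers while matrix entries see only residues; the two
  arguments differ by an integer, where every mode is 1.\<close>

lemma fourier_mode_mod: "fourier_mode k (real (nat (n mod int p)) / real p) = fourier_mode k (of_int n / real p)"
  if "1 \<le> p"
proof -
  have "real_of_int n = real p * of_int (n div int p) + of_int (n mod int p)"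
    by (metis mult_div_mod_eq of_int_add of_int_mult of_int_of_nat_eq)
  then have "real_of_int n / real p = real (nat (n mod int p)) / real p + of_int (n div int p)"
    using that by (simp add: add_divide_distrib)
  then show ?thesis by (simp add: fourier_mode_add_right)
qed

section \<open>Tensor operators built from clock and shift, and the two generators\<close>

lemma dim_vec_tensor_op [simp]: "dim_vec (tensor_op A M h) = dim_row M"
  by (simp add: tensor_op_def)

lemma tensor_op_phase:
  assumes "h \<in> carrier_vec p" "n < p"
  shows "tensor_op A (phase_mat p k) h $ n = (\<lambda>t. fourier_mode (- k) (n / p) * A (h $ n) t)"
proof -
  have "(tensor_op A (phase_mat p k) h $ n) t =
      (\<Sum>m<p. (if n = m then fourier_mode (- k) (n / p) else 0) * A (h $ m) t)" for t
    using assms by (simp add: tensor_op_def phase_mat_def)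
  then show ?thesis using assms(2) by (simp add: fun_eq_iff if_distrib[of "\<lambda>x. x * _"] cong: if_cong)
qed

lemma tensor_op_phase_shift:
  assumes "h \<in> carrier_vec p" "n < p"
  shows "tensor_op A (phase_mat p k * shift_mat p) h $ n =
    (\<lambda>t. fourier_mode (- k) (n / p) * A (h $ nat ((int n - 1) mod int p)) t)"
proof -
  have S: "shift_mat p \<in> carrier_mat p p" by (simp add: shift_mat_def)
  let ?m = "nat ((int n - 1) mod int p)"
  \<comment> \<open>Restates the integer condition of \<open>shift_mat\<close> as an equation of
    naturals, so that the sum over \<open>m\<close> collapses to one term.\<close>
  have m: "?m < p" "\<And>m. int m = (int n - 1) mod int p \<longleftrightarrow> ?m = m"
    using assms(2) by (auto simp: nat_less_iff)
  have "(tensor_op A (phase_mat p k * shift_mat p) h $ n) t =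
      (\<Sum>m<p. (if ?m = m then fourier_mode (- k) (n / p) else 0) * A (h $ m) t)" for t
    using assms phase_mat_mult_index[OF S assms(2)] S
    by (auto simp: tensor_op_def shift_mat_def phase_mat_def m(2) intro!: sum.cong)
  then show ?thesis using m(1) by (simp add: fun_eq_iff if_distrib[of "\<lambda>x. x * _"] cong: if_cong)
qed

theorem proposition4p3:
  fixes \<theta> :: real and p :: nat and r s :: int and \<tau> :: complex
    and f :: "(real \<Rightarrow> complex) Matrix.vec"
  assumes "0 \<le> \<theta>" and "\<theta> < 1" and "1 \<le> p"
    and "0 < real_of_int s + real p * \<theta> / 2"
    and "\<tau> = Complex (real_of_int r) (real_of_int s + real p * \<theta> / 2)"
    and "f \<in> H_module p"
  shows "transported_act \<theta> \<tau> p f gen_U =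
           scale_tuple (exp (pi * \<i> * (real_of_int r / real p)))
             (tensor_op (Weyl (real_of_int s / real p + \<theta>) 0)
               (mat_int_pow p (mat_adjoint (clock_mat p)) r * shift_mat p) f) \<and>
         transported_act \<theta> \<tau> p f gen_V =
           tensor_op (Weyl 0 1) (mat_int_pow p (mat_adjoint (clock_mat p)) s) f"
proof -
  have \<tau>: "Re \<tau> = of_int r" "0 < Im \<tau>" using assms by simp_all
  define \<delta> where "\<delta> = Im \<tau> / p"
  have \<delta>: "\<delta> = real_of_int s / real p + \<theta> / 2"
    using assms(3,5) by (simp add: \<delta>_def add_divide_distrib)
  have f: "f \<in> carrier_vec p" "\<And>n. n < p \<Longrightarrow> f $ n \<in> schwartz"
    using assms(6) by (auto simp: H_module_def)
  have res: "nat (n mod int p) < p" for n using assms(3) by (simp add: nat_less_iff)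
  note trans = transported_act_eqI[OF assms(6) \<tau>(1) assms(3) \<tau>(2)]
  let ?hU = "scale_tuple (exp (pi * \<i> * (real_of_int r / real p)))
      (tensor_op (Weyl (real_of_int s / real p + \<theta>) 0) (phase_mat p r * shift_mat p) f)"
  have hU: "?hU $ n = (\<lambda>t. exp (pi * \<i> * (real_of_int r / real p)) * fourier_mode (- r) (n / p) *
      (f $ nat ((int n - 1) mod int p)) (t - (real_of_int s / real p + \<theta>)))" if "n < p" for n
    using that by (simp add: scale_tuple_def tensor_op_phase_shift[OF f(1) that] Weyl_def mult.assoc)
  have "transported_act \<theta> \<tau> p f gen_U = ?hU"
  proof (rule trans)
    show "?hU \<in> H_module p"
      unfolding H_module_def
    proof (intro CollectI conjI allI impI)
      show "?hU \<in> carrier_vec p" by (intro carrier_vecI) (simp add: scale_tuple_def)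
      show "?hU $ n \<in> schwartz" if "n < p" for n
        unfolding hU[OF that] by (intro schwartz_cmult schwartz_translate f(2) res)
    qed
    fix g assume "decomposes \<tau> p g f"
    then have sum: "((\<lambda>n. gauss_phase \<tau> p n * (f $ nat (n mod int p)) (Im z + n * \<delta>) * fourier_mode n (Re z))
        has_sum g z) UNIV" for z
      by (simp add: decomposes_iff \<delta>_def)
    show "decomposes \<tau> p (act \<theta> g gen_U) ?hU"
      unfolding decomposes_iff act_gen
    proof
      fix z
      let ?w = "Complex (Re z) (Im z - \<theta> / 2)"
      let ?a = "\<lambda>n. gauss_phase \<tau> p n * (f $ nat (n mod int p)) (Im ?w + n * \<delta>) * fourier_mode n (Re ?w)"
      \<comment> \<open>The factor e^(2\<pi>ix) of \<open>act_U\<close> raises each frequency by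
        one, so the term of index n comes from n - 1; this is the shift matrix.\<close>
      have "bij (\<lambda>n::int. n - 1)" by (rule o_bij[of "\<lambda>n. n + 1"]) auto
      from iffD2[OF has_sum_reindex_bij_betw[OF this] has_sum_cmult_right[OF sum[of ?w], of "fourier_mode 1 (Re z)"]]
      have "((\<lambda>n. fourier_mode 1 (Re z) * ?a (n - 1)) has_sum fourier_mode 1 (Re z) * g ?w) UNIV" .
      also have "fourier_mode 1 (Re z) * g ?w = act_U \<theta> g z"
        by (simp add: act_U_def fourier_mode_def)
      also have "(\<lambda>n. fourier_mode 1 (Re z) * ?a (n - 1)) =
        (\<lambda>n. gauss_phase \<tau> p n * (?hU $ nat (n mod int p)) (Im z + n * (Im \<tau> / p)) * fourier_mode n (Re z))"
      proof
        fix n :: int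
        \<comment> \<open>The step from n to n - 1 contributes \<delta> = s/p + \<theta>/2 and the
          translation of \<open>act_U\<close> another \<theta>/2: together the Weyl translation s/p
          + \<theta>.\<close>
        have arg: "Im z + n * (Im \<tau> / p) - (real_of_int s / real p + \<theta>) = Im ?w + real_of_int (n - 1) * \<delta>"
        proof -
          have "real_of_int s / real p + \<theta> = \<delta> + \<theta> / 2" by (simp add: \<delta>)
          then show ?thesis unfolding \<delta>_def[symmetric] by (simp add: algebra_simps)
        qed
        have idx: "(int (nat (n mod int p)) - 1) mod int p = (n - 1) mod int p"
          using assms(3) by (simp add: mod_diff_left_eq)
        \<comment> \<open>From (n - 1)^2 = n^2 - 2n + 1: the linear term is the clock factor, the
          constant term the scalar e^(\<pi>ir/p).\<close>
        have phase: "gauss_phase \<tau> p n * (exp (pi * \<i> * (real_of_int r / real p)) * fourier_mode (- r) (n / p)) =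
            gauss_phase \<tau> p (n - 1)"
          unfolding gauss_phase_def fourier_mode_def exp_add[symmetric] using assms(3) \<tau>(1)
          by (intro arg_cong[of _ _ exp]) (simp add: field_simps power2_eq_square)
        have mode: "fourier_mode 1 (Re z) * fourier_mode (n - 1) (Re z) = fourier_mode n (Re z)"
          using fourier_mode_add[of 1 "n - 1"] by simp
        show "fourier_mode 1 (Re z) * ?a (n - 1) =
          gauss_phase \<tau> p n * (?hU $ nat (n mod int p)) (Im z + n * (Im \<tau> / p)) * fourier_mode n (Re z)"
          unfolding hU[OF res] fourier_mode_mod[OF assms(3)] arg idx phase[symmetric] mode[symmetric]
          by (simp only: mult_ac complex.sel)
      qed
      finally show "((\<lambda>n. gauss_phase \<tau> p n * (?hU $ nat (n mod int p)) (Im z + n * (Im \<tau> / p)) *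
          fourier_mode n (Re z)) has_sum act_U \<theta> g z) UNIV" .
    qed
  qed
  moreover
  let ?hV = "tensor_op (Weyl 0 1) (phase_mat p s) f"
  \<comment> \<open>The explicit real \<open>1\<close> matches the parameter \<open>b\<close> of
    \<open>schwartz_modulate\<close>.\<close>
  have hV: "?hV $ n = (\<lambda>t. fourier_mode (- s) (n / p) * (exp (2 * pi * \<i> * (1 :: real) * complex_of_real t) * (f $ n) t))"
    if "n < p" for n
    unfolding tensor_op_phase[OF f(1) that] by (simp add: Weyl_def)
  have "transported_act \<theta> \<tau> p f gen_V = ?hV"
  proof (rule trans)
    show "?hV \<in> H_module p"
      unfolding H_module_def
    proof (intro CollectI conjI allI impI)
      show "?hV \<in> carrier_vec p" by (intro carrier_vecI) simp
      show "?hV $ n \<in> schwartz" if "n < p" for n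
        unfolding hV[OF that] by (intro schwartz_cmult schwartz_modulate f(2) that)
    qed
    fix g assume "decomposes \<tau> p g f"
    then have sum: "((\<lambda>n. gauss_phase \<tau> p n * (f $ nat (n mod int p)) (Im z + n * \<delta>) * fourier_mode n (Re z))
        has_sum g z) UNIV" for z
      by (simp add: decomposes_iff \<delta>_def)
    show "decomposes \<tau> p (act \<theta> g gen_V) ?hV"
      unfolding decomposes_iff act_gen
    proof
      fix z
      let ?w = "Complex (Re z + \<theta> / 2) (Im z)"
      let ?a = "\<lambda>n. gauss_phase \<tau> p n * (f $ nat (n mod int p)) (Im ?w + n * \<delta>) * fourier_mode n (Re ?w)"
      have "((\<lambda>n. fourier_mode 1 (Im z) * ?a n) has_sum fourier_mode 1 (Im z) * g ?w) UNIV"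
        by (rule has_sum_cmult_right[OF sum])
      also have "fourier_mode 1 (Im z) * g ?w = act_V \<theta> g z"
        by (simp add: act_V_def fourier_mode_def)
      also have "(\<lambda>n. fourier_mode 1 (Im z) * ?a n) =
        (\<lambda>n. gauss_phase \<tau> p n * (?hV $ nat (n mod int p)) (Im z + n * (Im \<tau> / p)) * fourier_mode n (Re z))"
      proof
        fix n :: int
        \<comment> \<open>Writing Im z as (Im z + n\<delta>) - n\<delta> produces the Weyl
          modulation and e^(-2\<pi>in\<delta>). Its \<theta>-part e^(-\<pi>in\<theta>) cancels
          against the mode at Re z + \<theta>/2, and the clock factor e^(-2\<pi>ins/p)
          remains.\<close>
        have phase: "fourier_mode 1 (Im z) * fourier_mode n (Re ?w) = fourier_mode (- s) (n / p) *
            exp (2 * pi * \<i> * (1 :: real) * complex_of_real (Im z + n * \<delta>)) * fourier_mode n (Re z)"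
          unfolding \<delta> fourier_mode_def exp_add[symmetric]
          by (intro arg_cong[of _ _ exp]) (simp add: algebra_simps)
        have "fourier_mode 1 (Im z) * ?a n = gauss_phase \<tau> p n * (f $ nat (n mod int p)) (Im z + n * \<delta>) *
            (fourier_mode 1 (Im z) * fourier_mode n (Re ?w))"
          by simp
        then show "fourier_mode 1 (Im z) * ?a n =
          gauss_phase \<tau> p n * (?hV $ nat (n mod int p)) (Im z + n * (Im \<tau> / p)) * fourier_mode n (Re z)"
          unfolding hV[OF res] fourier_mode_mod[OF assms(3)] phase \<delta>_def[symmetric] by (simp only: mult_ac)
      qed
      finally show "((\<lambda>n. gauss_phase \<tau> p n * (?hV $ nat (n mod int p)) (Im z + n * (Im \<tau> / p)) *
          fourier_mode n (Re z)) has_sum act_V \<theta> g z) UNIV" .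
    qed
  qed
  ultimately show ?thesis unfolding mat_int_pow_adjoint_clock by blast
qed

end
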